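(* Let $X$ be a completely regular topological space and let $Y$ be a nonempty completely regular topological space in which all compact subsets are metrizable. Equip $X\times Y$ with the product topology. (1) If $X$ possesses property (tud), then $X\times Y$ possesses property (tud). (2) If $X$ possesses property (ud), then $X\times Y$ possesses property (ud).
   Context: Completely regular spaces are assumed Hausdorff. For a completely regular space $Z$, $C_b(Z)$ denotes the space of bounded continuous real functions on $Z$. A (finite) nonnegative measure $\mu$ on the Borel $\sigma$-algebra of $Z$ is called Radon if for every Borel set $B\subset Z$ and every $\varepsilon>0$ there is a compact set $K\subset B$ with $\mu(B\setminus K)<\varepsilon$. A sequence of Radon measures $\mu_n$ on $Z$ converges weakly to a Radon measure $\mu$ if $\int_Z f\,d\mu_n\to\int_Z f\,d\mu$ for every $f\in C_b(Z)$. A sequence of nonnegative Radon measures $\mu_n$ on $Z$ is uniformly tight if for every $\varepsilon>0$ there is a compact set $K_\varepsilon\subset Z$ such that $\mu_n(Z\setminus K_\varepsilon)<\varepsilon$ for all $n$. Let $\delta_a$ denote the probability measure concentrated at the point $a$. Let $\mu$ be a Radon probability measure on $Z$. A sequence of points $z_n\in Z$ is uniformly distributed with respect to $\mu$ if $\int_Z f\,d\mu=\lim_{n\to\infty}\frac{f(z_1)+\cdots+f(z_n)}{n}$ for every $f\in C_b(Z)$; equivalently, the measures $n^{-1}(\delta_{z_1}+\cdots+\delta_{z_n})$ converge weakly to $\mu$. The measure $\mu$ has a $t$-uniformly distributed sequence if there is a sequence of points $z_n\in Z$ such that the sequence of measures $n^{-1}(\delta_{z_1}+\cdots+\delta_{z_n})$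 is uniformly tight and converges weakly to $\mu$. The space $Z$ possesses property (ud) if every Radon probability measure on $Z$ has a uniformly distributed sequence. The space $Z$ possesses property (tud) if every Radon probability measure on $Z$ has a $t$-uniformly distributed sequence. *)

theory Defs
  imports "HOL-Probability.Probability"
begin

definition borel_of :: "'a topology \<Rightarrow> 'a measure" where
  "borel_of X = sigma (topspace X) {U. openin X U}"

definition bounded_continuous :: "'a topology \<Rightarrow> ('a \<Rightarrow> real) set" where
  "bounded_continuous X = {f. continuous_map X euclideanreal f \<and> bounded (f ` topspace X)}"

(* In Hausdorff spaces, the only ones considered below, compact sets are closed, so all
   sets to which "measure" is applied here and in uniformly_tight are measurable. *)
definition radon_measure :: "'a topology \<Rightarrow> 'a measure \<Rightarrow> bool" where
  "radon_measure X M \<longleftrightarrow>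
     sets M = sets (borel_of X) \<and> finite_measure M \<and>
     (\<forall>B\<in>sets M. \<forall>\<epsilon>>0. \<exists>K. compactin X K \<and> K \<subseteq> B \<and> measure M (B - K) < \<epsilon>)"

definition converges_weakly ::
  "'a topology \<Rightarrow> (nat \<Rightarrow> 'a measure) \<Rightarrow> 'a measure \<Rightarrow> bool" where
  "converges_weakly X Ms M \<longleftrightarrow>
     (\<forall>f\<in>bounded_continuous X. (\<lambda>n. integral\<^sup>L (Ms n) f) \<longlonglongrightarrow> integral\<^sup>L M f)"

definition uniformly_tight :: "'a topology \<Rightarrow> (nat \<Rightarrow> 'a measure) \<Rightarrow> bool" where
  "uniformly_tight X Ms \<longleftrightarrow>
     (\<forall>\<epsilon>>0. \<exists>K. compactin X K \<and> (\<forall>n. measure (Ms n) (topspace X - K) < \<epsilon>))"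

(* The average of the Dirac measures at z 0, ..., z (n - 1); meaningful for n > 0. *)
definition empirical_measure :: "'a topology \<Rightarrow> (nat \<Rightarrow> 'a) \<Rightarrow> nat \<Rightarrow> 'a measure" where
  "empirical_measure X z n =
     measure_of (topspace X) (sets (borel_of X))
       (\<lambda>B. (\<Sum>i<n. emeasure (return (borel_of X) (z i)) B) / of_nat n)"

definition uniformly_distributed ::
  "'a topology \<Rightarrow> 'a measure \<Rightarrow> (nat \<Rightarrow> 'a) \<Rightarrow> bool" where
  "uniformly_distributed X M z \<longleftrightarrow>
     range z \<subseteq> topspace X \<and>
     (\<forall>f\<in>bounded_continuous X. (\<lambda>n. (\<Sum>i<n. f (z i)) / real n) \<longlonglongrightarrow> integral\<^sup>L M f)"

(* Suc n: the sequence of averages starts with the average over one point. *)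
definition t_uniformly_distributed ::
  "'a topology \<Rightarrow> 'a measure \<Rightarrow> (nat \<Rightarrow> 'a) \<Rightarrow> bool" where
  "t_uniformly_distributed X M z \<longleftrightarrow>
     range z \<subseteq> topspace X \<and>
     uniformly_tight X (\<lambda>n. empirical_measure X z (Suc n)) \<and>
     converges_weakly X (\<lambda>n. empirical_measure X z (Suc n)) M"

definition property_ud :: "'a topology \<Rightarrow> bool" where
  "property_ud X \<longleftrightarrow>
     (\<forall>M. radon_measure X M \<and> prob_space M \<longrightarrow> (\<exists>z. uniformly_distributed X M z))"

definition property_tud :: "'a topology \<Rightarrow> bool" where
  "property_tud X \<longleftrightarrow>
     (\<forall>M. radon_measure X M \<and> prob_space M \<longrightarrow> (\<exists>z. t_uniformly_distributed X M z))"

lemma space_borel_of [simp]: "space (borel_of X) = topspace X"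
  unfolding borel_of_def by (rule space_measure_of) (auto dest: openin_subset)

lemma sets_empirical_measure [simp]:
  "sets (empirical_measure X z n) = sets (borel_of X)"
  unfolding empirical_measure_def by (metis sets.sets_measure_of_eq space_borel_of)

lemma emeasure_empirical_measure:
  assumes "B \<in> sets (borel_of X)"
  shows "emeasure (empirical_measure X z n) B =
    (\<Sum>i<n. emeasure (return (borel_of X) (z i)) B) / of_nat n"
proof (rule emeasure_measure_of[OF empirical_measure_def])
  show "sets (borel_of X) \<subseteq> Pow (topspace X)"
    by (metis sets.space_closed space_borel_of)
  show "B \<in> sets (empirical_measure X z n)"
    using assms by simp
  show "positive (sets (empirical_measure X z n))
     (\<lambda>B. (\<Sum>i<n. emeasure (return (borel_of X) (z i)) B) / of_nat n)"
    by (simp add: positive_def)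
  show "countably_additive (sets (empirical_measure X z n))
     (\<lambda>B. (\<Sum>i<n. emeasure (return (borel_of X) (z i)) B) / of_nat n)"
  proof (rule countably_additiveI)
    fix A :: "nat \<Rightarrow> 'a set"
    assume A: "range A \<subseteq> sets (empirical_measure X z n)" "disjoint_family A"
    have "(\<Sum>j. (\<Sum>i<n. emeasure (return (borel_of X) (z i)) (A j)) / of_nat n) =
      (\<Sum>i<n. \<Sum>j. emeasure (return (borel_of X) (z i)) (A j)) / of_nat n"
      by (subst ennreal_suminf_divide) (simp add: suminf_sum)
    also have "\<dots> = (\<Sum>i<n. emeasure (return (borel_of X) (z i)) (\<Union>j. A j)) / of_nat n"
      using A by (subst suminf_emeasure) (simp_all del: emeasure_return)
    finally show "(\<Sum>j. (\<Sum>i<n. emeasure (return (borel_of X) (z i)) (A j)) / of_nat n) =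
      (\<Sum>i<n. emeasure (return (borel_of X) (z i)) (\<Union>j. A j)) / of_nat n" .
  qed
qed

lemma prob_space_empirical_measure:
  assumes "range z \<subseteq> topspace X" and "n > 0"
  shows "prob_space (empirical_measure X z n)"
proof
  have sp: "space (empirical_measure X z n) = topspace X"
    by (metis sets_eq_imp_space_eq sets_empirical_measure space_borel_of)
  have top: "topspace X \<in> sets (borel_of X)"
    by (metis sets.top space_borel_of)
  have "emeasure (return (borel_of X) (z i)) (topspace X) = 1" for i
    using assms(1) top by (auto simp: indicator_def)
  then show "emeasure (empirical_measure X z n) (space (empirical_measure X z n)) = 1"
    using assms(2) top
    by (simp add: sp emeasure_empirical_measure ennreal_divide_self of_nat_less_top
          del: emeasure_return)
qed

end

theory Submission
  imports Defs "HOL-Library.Nat_Bijection" "HOL-Real_Asymp.Real_Asymp"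
begin

text \<open>Let \<open>M\<close> be a Radon probability measure on the product. If \<open>M\<close> were the semidirect product of its projection
\<open>m\<close> to \<open>X\<close> and a kernel \<open>x \<mapsto> \<psi>(x)\<close> of probability measures on \<open>Y\<close> that is weakly continuous in \<open>x\<close>, the
following would work: take a sequence \<open>x i\<close> that is uniformly distributed for \<open>m\<close>, and for every \<open>i\<close> a
sequence \<open>y i j\<close> (\<open>j = 0, 1, \<dots>\<close>) that is uniformly distributed for \<open>\<psi>(x i)\<close> with an error that does not
depend on \<open>i\<close>; then enumerate the pairs \<open>(x i, y i j)\<close> along the diagonals. For bounded continuous
\<open>f\<close>, the averages over \<open>j\<close> are close to the continuous function \<open>x \<mapsto> \<integral>f(x, \<cdot>) d\<psi>(x)\<close> at the point \<open>x i\<close>,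
and the averages of that function over \<open>i\<close> converge by the choice of \<open>x\<close>. Repeating every \<open>x i\<close>
infinitely often is what makes this work: thinning out a single sequence would require testing
discontinuous functions on \<open>X\<close>. The counting is done in \<open>diagonal_average_le\<close>.

Three reductions lead to this situation. First, a Radon measure lives, up to small mass, on a
compact rectangle \<open>K \<times> C\<close> where \<open>C\<close> is compact and hence metrizable. A countable base of \<open>C\<close> cuts \<open>C\<close> along a
binary tree of Borel cells; \<open>M\<close> is then encoded by the conditional probabilities \<open>p s x\<close> of moving to
one of the two children of a node \<open>s\<close> (\<open>transition_probabilities\<close>), which are Radon-Nikodym
derivatives and thus only measurable in \<open>x\<close>. By Lusin's theorem (\<open>radon_lusin\<close>) the set \<open>K\<close> can be chosen such
that all the \<open>p s\<close> are continuous on \<open>K\<close>, and since \<open>X\<close> is completely regular, each of them extends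
continuously to all of \<open>X\<close> with values in \<open>[0,1]\<close>. Extending conditional probabilities on a tree, rather
than the probabilities of the cells themselves, keeps the extended kernels consistent at all depths.
The extension matters because the points \<open>x i\<close> need not lie in \<open>K\<close>.

Secondly, at a fixed \<open>x\<close> the sequence \<open>y i j\<close> comes from a rotor walk on the tree: a node \<open>s\<close>
sends \<open>\<lfloor>c * p s\<rfloor>\<close> of its first \<open>c\<close> visitors to one child and the others to the other child. The number of visits to a node of
depth \<open>k\<close> then differs from its expected value by at most \<open>k\<close>, whatever \<open>p\<close> is (\<open>visits_approx\<close>). The
oscillation of \<open>f(x, \<cdot>)\<close> on the cells of depth \<open>k\<close> is a continuous function of \<open>x\<close> that tends to \<open>0\<close>
pointwise, so its integral tends to \<open>0\<close>; this controls the error made by replacing a cell by a point.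

Thirdly, the passage from part of the mass to all of it is a bisection: whenever at least half of the mass
can be treated, \<open>M = (M1 + M2) / 2\<close> with \<open>M1\<close> treated and \<open>M2\<close> again a Radon probability measure. Iterating
this and interleaving the sequences with frequencies \<open>1/2, 1/4, \<dots>\<close> gives a sequence for \<open>M\<close>
(\<open>ud_sequence_by_halving\<close>). Every step preserves uniform tightness, so that both parts of the
theorem are proved at once.\<close>

section \<open>Averages along the diagonals of a double sequence\<close>

text \<open>The first \<open>triangle R\<close> values of \<open>prod_decode\<close> fill the triangle \<open>i + j < R\<close>, in which the column of \<open>i\<close> is an
initial segment \<open>j < R - i\<close>. So estimates for initial segments of the columns are all that is needed.\<close>
lemma sum_prod_decode_triangle:
  fixes g :: "nat \<Rightarrow> nat \<Rightarrow> 'a::comm_monoid_add"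
  shows "(\<Sum>N<triangle R. case_prod g (prod_decode N)) = (\<Sum>i<R. \<Sum>j<R - i. g i j)"
proof (induction R)
  case 0
  then show ?case by simp
next
  case (Suc R)
  have dec: "prod_decode (triangle R + m) = (m, R - m)" if "m \<le> R" for m
    using that by (simp add: prod_decode_triangle_add prod_decode_aux.simps)
  have "(\<Sum>N<triangle (Suc R). case_prod g (prod_decode N)) =
      (\<Sum>N<triangle R. case_prod g (prod_decode N)) +
      (\<Sum>N=triangle R..<triangle R + Suc R. case_prod g (prod_decode N))"
    by (simp add: lessThan_atLeast0 sum.atLeastLessThan_concat del: sum.op_ivl_Suc)
  also have "(\<Sum>N=triangle R..<triangle R + Suc R. case_prod g (prod_decode N)) =
      (\<Sum>m<Suc R. case_prod g (prod_decode (triangle R + m)))"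
    using sum.shift_bounds_nat_ivl[of "\<lambda>N. case_prod g (prod_decode N)" 0 "triangle R" "Suc R"]
    by (simp add: lessThan_atLeast0 add.commute del: sum.op_ivl_Suc)
  also have "\<dots> = (\<Sum>m<Suc R. g m (R - m))"
    by (intro sum.cong) (auto simp: dec)
  also have "(\<Sum>N<triangle R. case_prod g (prod_decode N)) + \<dots> =
      (\<Sum>i<Suc R. (\<Sum>j<R - i. g i j) + g i (R - i))"
    by (simp add: Suc.IH sum.distrib add_ac)
  also have "\<dots> = (\<Sum>i<Suc R. \<Sum>j<Suc R - i. g i j)"
    by (intro sum.cong) (auto simp: Suc_diff_le)
  finally show ?case .
qed

text \<open>The column of \<open>i\<close> enters with weight \<open>R - i\<close>. Such decreasing weights amount to averaging the partial sums once more, which preserves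
limits and bounds of averages.\<close>
lemma sum_weighted_triangle:
  fixes u :: "nat \<Rightarrow> real"
  shows "(\<Sum>i<R. real (R - i) * u i) = (\<Sum>r\<le>R. \<Sum>i<r. u i)"
proof (induction R)
  case 0
  then show ?case by simp
next
  case (Suc R)
  have "(\<Sum>i<Suc R. real (Suc R - i) * u i) = (\<Sum>i<Suc R. real (R - i) * u i + u i)"
    by (intro sum.cong) (auto simp: Suc_diff_le algebra_simps)
  then show ?case using Suc by (simp add: sum.distrib)
qed

lemma real_triangle: "real (triangle R) = real R * (real R + 1) / 2"
proof (induction R)
  case (Suc R)
  then show ?case by (simp add: field_simps)
qed simp

lemma sum_atMost_triangle: "(\<Sum>r\<le>R. real r) = real (triangle R)"
  by (induction R) auto

lemma between_triangles:
  obtains R where "triangle R \<le> n" "n < triangle (Suc R)"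
proof -
  have "n < triangle (Suc n)" by simp
  then obtain R where R: "n < triangle (Suc R)" "\<And>r. r < R \<Longrightarrow> \<not> n < triangle (Suc r)"
    using exists_least_iff[of "\<lambda>r. n < triangle (Suc r)"] by blast
  have "triangle R \<le> n"
  proof (cases R)
    case (Suc r)
    then show ?thesis using R(2)[of r] by simp
  qed simp
  with R(1) that show ?thesis by blast
qed

text \<open>The additive constant turns an eventual estimate into one for all \<open>n\<close>, which can then be summed.\<close>
lemma eventual_average_bound:
  fixes u :: "nat \<Rightarrow> real"
  assumes "(\<lambda>n. (\<Sum>i<n. u i) / real n) \<longlonglongrightarrow> \<beta>" and "\<epsilon> > 0"
  obtains C where "C \<ge> 0" "\<And>n. (\<Sum>i<n. u i) \<le> (\<beta> + \<epsilon>) * real n + C"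
proof -
  have "eventually (\<lambda>n. (\<Sum>i<n. u i) / real n < \<beta> + \<epsilon>) sequentially"
    using assms by (intro order_tendstoD(2)) auto
  then obtain n0 where n0: "\<And>n. n \<ge> n0 \<Longrightarrow> (\<Sum>i<n. u i) / real n < \<beta> + \<epsilon>"
    by (auto simp: eventually_sequentially)
  define C where "C = (\<Sum>n\<le>n0. \<bar>(\<Sum>i<n. u i) - (\<beta> + \<epsilon>) * real n\<bar>)"
  show thesis
  proof
    show C0: "C \<ge> 0" by (simp add: C_def sum_nonneg)
    fix n show "(\<Sum>i<n. u i) \<le> (\<beta> + \<epsilon>) * real n + C"
    proof (cases "n \<le> n0")
      case True
      then have "\<bar>(\<Sum>i<n. u i) - (\<beta> + \<epsilon>) * real n\<bar> \<le> C"
        unfolding C_def by (intro member_le_sum) auto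
      then show ?thesis by linarith
    next
      case False
      then have "(\<Sum>i<n. u i) < (\<beta> + \<epsilon>) * real n"
        using n0[of n] by (auto simp: divide_simps split: if_splits)
      then show ?thesis using C0 by linarith
    qed
  qed
qed

text \<open>A one-sided estimate suffices: applied to a function and to its negative it yields convergence. The constant \<open>D\<close> must
not depend on the column; over \<open>R\<close> columns it adds up to \<open>R * D\<close>, and so does the unfinished last
diagonal up to a factor, while the number of terms is of order \<open>R\<^sup>2\<close>.\<close>
lemma diagonal_average_le:
  fixes h :: "nat \<Rightarrow> nat \<Rightarrow> real"
  assumes bd: "\<And>i j. \<bar>h i j\<bar> \<le> B"
    and col: "\<And>i J. (\<Sum>j<J. h i j) \<le> D + real J * u i"
    and lim: "(\<lambda>n. (\<Sum>i<n. u i) / real n) \<longlonglongrightarrow> \<beta>" and "\<epsilon> > 0"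
  shows "eventually (\<lambda>n. (\<Sum>N<n. case_prod h (prod_decode N)) / real n \<le> \<beta> + \<epsilon>) sequentially"
proof -
  define \<gamma> where "\<gamma> = \<beta> + \<epsilon> / 2"
  obtain C where C: "C \<ge> 0" "\<And>n. (\<Sum>i<n. u i) \<le> \<gamma> * real n + C"
    using eventual_average_bound[OF lim, of "\<epsilon> / 2"] \<open>\<epsilon> > 0\<close> unfolding \<gamma>_def by auto
  have B: "B \<ge> 0" using bd[of 0 0] by linarith
  define C' where "C' = \<bar>D\<bar> + C + \<bar>\<gamma>\<bar> + B"
  have main: "(\<Sum>N<n. case_prod h (prod_decode N)) \<le> \<gamma> * real n + C' * (sqrt (2 * real n) + 1)" for n
  proof -
    obtain R where R: "triangle R \<le> n" "n < triangle (Suc R)"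
      by (rule between_triangles)
    have nR: "real n - real (triangle R) \<le> real R + 1" "real (triangle R) \<le> real n"
      using R by auto
    have "(real R)^2 \<le> 2 * real n"
      using nR(2) unfolding real_triangle by (simp add: power2_eq_square field_simps)
    then have Rs: "real R \<le> sqrt (2 * real n)" by (rule real_le_rsqrt)
    have "(\<Sum>N<n. case_prod h (prod_decode N)) =
        (\<Sum>N<triangle R. case_prod h (prod_decode N)) + (\<Sum>N=triangle R..<n. case_prod h (prod_decode N))"
      using R by (simp add: lessThan_atLeast0 sum.atLeastLessThan_concat)
    also have "(\<Sum>N=triangle R..<n. case_prod h (prod_decode N)) \<le> (\<Sum>N=triangle R..<n. B)"
      by (intro sum_mono) (use bd in \<open>auto split: prod.splits intro: order_trans[OF abs_ge_self]\<close>)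
    also have "(\<Sum>N=triangle R..<n. B) \<le> B * (real R + 1)"
      using nR R B by (simp add: mult.commute mult_left_mono of_nat_diff)
    also have "(\<Sum>N<triangle R. case_prod h (prod_decode N)) = (\<Sum>i<R. \<Sum>j<R - i. h i j)"
      by (rule sum_prod_decode_triangle)
    also have "\<dots> \<le> (\<Sum>i<R. D + real (R - i) * u i)"
      by (intro sum_mono col)
    also have "\<dots> = real R * D + (\<Sum>r\<le>R. \<Sum>i<r. u i)"
      by (simp add: sum.distrib sum_weighted_triangle[symmetric])
    also have "(\<Sum>r\<le>R. \<Sum>i<r. u i) \<le> (\<Sum>r\<le>R. \<gamma> * real r + C)"
      by (intro sum_mono C)
    also have "\<dots> = \<gamma> * real (triangle R) + C * (real R + 1)"
      by (simp add: sum.distrib sum_distrib_left[symmetric] sum_atMost_triangle algebra_simps)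
    also have "\<gamma> * real (triangle R) \<le> \<gamma> * real n + \<bar>\<gamma>\<bar> * (real R + 1)"
    proof -
      have "- \<gamma> * (real n - real (triangle R)) \<le> \<bar>\<gamma>\<bar> * (real R + 1)"
        using nR by (intro mult_mono) auto
      then show ?thesis by (simp add: algebra_simps)
    qed
    also have "real R * D \<le> \<bar>D\<bar> * (real R + 1)"
      by (simp add: mult.commute[of "real R"] mult_mono)
    finally have "(\<Sum>N<n. case_prod h (prod_decode N)) \<le> \<gamma> * real n + C' * (real R + 1)"
      by (simp add: C'_def algebra_simps)
    also have "C' * (real R + 1) \<le> C' * (sqrt (2 * real n) + 1)"
      using Rs C B by (intro mult_left_mono) (auto simp: C'_def)
    finally show ?thesis by simp
  qed
  have "(\<lambda>n. C' * (sqrt (2 * real n) + 1) / real n) \<longlonglongrightarrow> 0"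
    by real_asymp
  then have "eventually (\<lambda>n. C' * (sqrt (2 * real n) + 1) / real n < \<epsilon> / 2) sequentially"
    using \<open>\<epsilon> > 0\<close> by (intro order_tendstoD(2)) auto
  then show ?thesis
    using eventually_gt_at_top[of 0]
  proof eventually_elim
    case (elim n)
    have "(\<Sum>N<n. case_prod h (prod_decode N)) / real n \<le>
        (\<gamma> * real n + C' * (sqrt (2 * real n) + 1)) / real n"
      by (intro divide_right_mono main) auto
    also have "\<dots> = \<gamma> + C' * (sqrt (2 * real n) + 1) / real n"
      using elim by (simp add: add_divide_distrib)
    also have "\<dots> \<le> \<beta> + \<epsilon>" using elim(1) unfolding \<gamma>_def by linarith
    finally show ?case .
  qed
qed

text \<open>Here the estimate has to hold for every \<open>n\<close> and not only in the limit, as in the definition of uniform tightness. The factor \<open>3\<close> is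
the price of completing the last diagonal: \<open>triangle (Suc R) \<le> 3 * triangle R\<close> for \<open>R > 0\<close>.\<close>
lemma diagonal_count_le:
  assumes cnt: "\<And>n. real (card {i. i < n \<and> Q i}) \<le> \<epsilon> * real n" and "\<epsilon> \<ge> 0"
  shows "real (card {N. N < n \<and> Q (fst (prod_decode N))}) \<le> 3 * \<epsilon> * real n"
proof (cases "n = 0")
  case False
  obtain R where R: "triangle R \<le> n" "n < triangle (Suc R)"
    by (rule between_triangles)
  have "R \<noteq> 0" using R False by (cases R) auto
  then have "triangle (Suc R) \<le> 3 * triangle R" by (cases R) auto
  then have tr: "real (triangle (Suc R)) \<le> 3 * real (triangle R)"
    by (metis of_nat_le_iff of_nat_mult of_nat_numeral)
  let ?q = "\<lambda>i. of_bool (Q i) :: real"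
  have card_eq: "real (card {i. i < n \<and> P i}) = (\<Sum>i<n. of_bool (P i))" for n :: nat and P
  proof -
    have "{i. i < n \<and> P i} = {..<n} \<inter> {i. P i}" by auto
    then show ?thesis by simp
  qed
  have "real (card {N. N < n \<and> Q (fst (prod_decode N))}) = (\<Sum>N<n. ?q (fst (prod_decode N)))"
    by (rule card_eq)
  also have "\<dots> \<le> (\<Sum>N<triangle (Suc R). ?q (fst (prod_decode N)))"
    using R by (intro sum_mono2) auto
  also have "\<dots> = (\<Sum>N<triangle (Suc R). case_prod (\<lambda>i j. ?q i) (prod_decode N))"
    by (simp add: case_prod_unfold)
  also have "\<dots> = (\<Sum>i<Suc R. real (Suc R - i) * ?q i)"
    by (subst sum_prod_decode_triangle) simp
  also have "\<dots> = (\<Sum>r\<le>Suc R. \<Sum>i<r. ?q i)"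
    by (rule sum_weighted_triangle)
  also have "\<dots> \<le> (\<Sum>r\<le>Suc R. \<epsilon> * real r)"
    by (intro sum_mono) (metis card_eq cnt)
  also have "\<dots> = \<epsilon> * real (triangle (Suc R))"
    by (simp only: sum_distrib_left[symmetric] sum_atMost_triangle)
  also have "\<dots> \<le> \<epsilon> * (3 * real n)"
    using tr R \<open>\<epsilon> \<ge> 0\<close> by (intro mult_left_mono) auto
  finally show ?thesis by (simp add: mult_ac)
qed simp

section \<open>Rotor walks on the binary tree\<close>

text \<open>Nodes of the tree are lists of bits with the last decision at the head. The number \<open>visits p s n\<close> is how many of the first
\<open>n\<close> walkers pass through the node \<open>s\<close>; it is prescribed, and \<open>route p j\<close> is the path that the
walker number \<open>j\<close> must take to realise these numbers.\<close>

fun visits :: "(bool list \<Rightarrow> real) \<Rightarrow> bool list \<Rightarrow> nat \<Rightarrow> nat" where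
  "visits p [] n = n"
| "visits p (d # s) n =
     (let t = nat \<lfloor>real (visits p s n) * p s\<rfloor> in if d then t else visits p s n - t)"

fun route :: "(bool list \<Rightarrow> real) \<Rightarrow> nat \<Rightarrow> nat \<Rightarrow> bool list" where
  "route p j 0 = []"
| "route p j (Suc k) =
     (visits p (True # route p j k) (Suc j) > visits p (True # route p j k) j) # route p j k"

fun node_prob :: "(bool list \<Rightarrow> real) \<Rightarrow> bool list \<Rightarrow> real" where
  "node_prob p [] = 1"
| "node_prob p (d # s) = node_prob p s * (if d then p s else 1 - p s)"

lemma length_route [simp]: "length (route p j k) = k"
  by (induction k) auto

lemma route_add: "\<exists>ds. route p j (k + l) = ds @ route p j k"
  by (induction l) auto

lemma floor_step:
  assumes "0 \<le> p" "p \<le> (1::real)"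
  shows "nat \<lfloor>real (Suc c) * p\<rfloor> = nat \<lfloor>real c * p\<rfloor> \<or> nat \<lfloor>real (Suc c) * p\<rfloor> = Suc (nat \<lfloor>real c * p\<rfloor>)"
proof -
  have "\<lfloor>real c * p\<rfloor> \<le> \<lfloor>real (Suc c) * p\<rfloor>"
    using assms by (intro floor_mono mult_right_mono) auto
  moreover have "\<lfloor>real (Suc c) * p\<rfloor> \<le> \<lfloor>real c * p + 1\<rfloor>"
    using assms by (intro floor_mono) (auto simp: algebra_simps)
  moreover have "\<lfloor>real c * p\<rfloor> \<ge> 0" using assms by simp
  ultimately have "\<lfloor>real (Suc c) * p\<rfloor> = \<lfloor>real c * p\<rfloor> \<or> \<lfloor>real (Suc c) * p\<rfloor> = \<lfloor>real c * p\<rfloor> + 1"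
    by linarith
  then show ?thesis using \<open>\<lfloor>real c * p\<rfloor> \<ge> 0\<close> by (auto simp: nat_add_distrib simp del: of_nat_Suc)
qed

lemma floor_le_self:
  assumes "0 \<le> p" "p \<le> (1::real)"
  shows "nat \<lfloor>real c * p\<rfloor> \<le> c"
proof -
  have "\<lfloor>real c * p\<rfloor> \<le> \<lfloor>real c * 1\<rfloor>"
    using assms by (intro floor_mono mult_left_mono) auto
  then show ?thesis by simp
qed

text \<open>Consistency of the walk: since \<open>p s\<close> lies in \<open>[0,1]\<close>, the value \<open>\<lfloor>c * p s\<rfloor>\<close> increases by \<open>0\<close> or \<open>1\<close> when \<open>c\<close> does, so a new visitor of
\<open>s\<close> increases the count of exactly one child.\<close>
lemma visits_Suc:
  assumes p: "\<And>s. 0 \<le> p s \<and> p s \<le> 1"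
  shows "visits p s (Suc j) = visits p s j + of_bool (route p j (length s) = s)"
proof (induction s)
  case Nil
  then show ?case by simp
next
  case (Cons d s)
  let ?c = "visits p s j"
  define t where "t c = nat \<lfloor>real c * p s\<rfloor>" for c :: nat
  show ?case
  proof (cases "route p j (length s) = s")
    case True
    then have c: "visits p s (Suc j) = Suc ?c" using Cons by simp
    have "t (Suc ?c) = t ?c \<or> t (Suc ?c) = Suc (t ?c)" "t ?c \<le> ?c" "t (Suc ?c) \<le> Suc ?c"
      using p floor_step floor_le_self unfolding t_def by blast+
    moreover have "visits p (e # s) j = (if e then t ?c else ?c - t ?c)"
      "visits p (e # s) (Suc j) = (if e then t (Suc ?c) else Suc ?c - t (Suc ?c))" for e
      by (simp_all only: visits.simps Let_def c t_def)
    ultimately show ?thesis using True by (cases d) (auto simp del: visits.simps of_nat_Suc)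
  next
    case False
    then have "visits p s (Suc j) = ?c" using Cons by simp
    then show ?thesis using False by (auto simp: Let_def)
  qed
qed

lemma visits_eq_sum:
  assumes "\<And>s. 0 \<le> p s \<and> p s \<le> 1"
  shows "visits p s n = (\<Sum>j<n. of_bool (route p j (length s) = s))"
proof (induction n)
  case 0
  have "visits p s 0 = 0" by (induction s) (auto simp: Let_def)
  then show ?case by simp
next
  case (Suc n)
  then show ?case using visits_Suc[of p s n] assms by simp
qed

lemma node_prob_bounds:
  assumes "\<And>s. 0 \<le> p s \<and> p s \<le> 1"
  shows "0 \<le> node_prob p s \<and> node_prob p s \<le> 1"
proof (induction s)
  case (Cons d s)
  then show ?case using assms[of s] by (auto intro!: mult_le_one)
qed simp

text \<open>Rounding contributes at most \<open>1\<close> at every level, and the error inherited from the parent is multiplied by a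
probability. The bound does not depend on \<open>p\<close>; this uniformity is the reason for choosing the points
deterministically.\<close>
lemma visits_approx:
  assumes p: "\<And>s. 0 \<le> p s \<and> p s \<le> 1"
  shows "\<bar>real (visits p s n) - real n * node_prob p s\<bar> \<le> real (length s)"
proof (induction s)
  case Nil
  then show ?case by simp
next
  case (Cons d s)
  define c q a where "c = real (visits p s n)" and "q = real n * node_prob p s"
    and "a = (if d then p s else 1 - p s)"
  have a: "0 \<le> a" "a \<le> 1" using p[of s] by (auto simp: a_def)
  have "real_of_int \<lfloor>c * p s\<rfloor> \<le> c * p s" "c * p s < real_of_int \<lfloor>c * p s\<rfloor> + 1" "\<lfloor>c * p s\<rfloor> \<ge> 0"
    using p[of s] by (auto simp: c_def)
  moreover have "nat \<lfloor>c * p s\<rfloor> \<le> visits p s n"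
    unfolding c_def using p by (intro floor_le_self) auto
  ultimately have "\<bar>real (visits p (d # s) n) - c * a\<bar> \<le> 1"
    by (auto simp: Let_def a_def c_def[symmetric] of_nat_diff algebra_simps)
  moreover have "\<bar>c * a - q * a\<bar> \<le> real (length s)"
  proof -
    have "\<bar>c * a - q * a\<bar> = \<bar>c - q\<bar> * a"
      using a by (simp add: left_diff_distrib[symmetric] abs_mult)
    also have "\<dots> \<le> \<bar>c - q\<bar>" using a by (simp add: mult_left_le)
    finally show ?thesis using Cons by (simp add: c_def q_def)
  qed
  moreover have "real n * node_prob p (d # s) = q * a" by (simp add: q_def a_def)
  ultimately show ?case by (simp only: length_Cons of_nat_Suc)
qed

section \<open>Uniformly distributed sequences in terms of averages and counts\<close>

definition tight_sequence :: "'a topology \<Rightarrow> (nat \<Rightarrow> 'a) \<Rightarrow> bool" where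
  "tight_sequence X z \<longleftrightarrow>
     (\<forall>\<epsilon>>0. \<exists>K. compactin X K \<and> (\<forall>n. real (card {i. i < n \<and> z i \<notin> K}) \<le> \<epsilon> * real n))"

text \<open>The flag \<open>t\<close> selects whether uniform tightness is demanded, so that the properties (ud) and (tud) can be treated by the same lemmas.\<close>
definition ud_sequence :: "bool \<Rightarrow> 'a topology \<Rightarrow> 'a measure \<Rightarrow> (nat \<Rightarrow> 'a) \<Rightarrow> bool" where
  "ud_sequence t X M z \<longleftrightarrow> uniformly_distributed X M z \<and> (t \<longrightarrow> tight_sequence X z)"

lemma sets_borel_of: "sets (borel_of X) = sigma_sets (topspace X) {U. openin X U}"
  unfolding borel_of_def by (rule sets_measure_of) (auto dest: openin_subset)

lemma openin_borel_of: "openin X U \<Longrightarrow> U \<in> sets (borel_of X)"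
  by (simp add: sets_borel_of sigma_sets.Basic)

lemma closedin_borel_of:
  assumes "closedin X S"
  shows "S \<in> sets (borel_of X)"
proof -
  have "topspace X - (topspace X - S) \<in> sets (borel_of X)"
    using assms openin_borel_of[of X "topspace X - S"] by (metis openin_diff openin_topspace sets.compl_sets space_borel_of)
  then show ?thesis using closedin_subset[OF assms] by (simp add: double_diff)
qed

lemma compactin_borel_of: "Hausdorff_space X \<Longrightarrow> compactin X K \<Longrightarrow> K \<in> sets (borel_of X)"
  by (simp add: closedin_borel_of compactin_imp_closedin)

lemma continuous_map_measurable:
  assumes "continuous_map X Y f"
  shows "f \<in> measurable (borel_of X) (borel_of Y)"
proof (unfold borel_of_def[of Y], rule measurable_sigma_sets[OF sets_measure_of])
  show "{U. openin Y U} \<subseteq> Pow (topspace Y)" by (auto dest: openin_subset)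
  then show "{U. openin Y U} \<subseteq> Pow (topspace Y)" .
  show "f \<in> space (borel_of X) \<rightarrow> topspace Y"
    using assms by (simp add: continuous_map_def)
  fix U assume "U \<in> {U. openin Y U}"
  then have "openin X {x \<in> topspace X. f x \<in> U}"
    using assms by (auto simp: continuous_map_def)
  moreover have "f -` U \<inter> space (borel_of X) = {x \<in> topspace X. f x \<in> U}" by auto
  ultimately show "f -` U \<inter> space (borel_of X) \<in> sets (borel_of X)"
    by (simp add: openin_borel_of)
qed

lemma borel_of_euclidean: "borel_of euclidean = borel"
  unfolding borel_of_def borel_def by simp

lemma continuous_map_borel_measurable:
  fixes f :: "'a \<Rightarrow> 'b::topological_space"
  assumes "continuous_map X euclidean f"
  shows "f \<in> borel_measurable (borel_of X)"
  using continuous_map_measurable[OF assms] by (simp add: borel_of_euclidean)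

lemma bounded_continuous_bound:
  assumes "f \<in> bounded_continuous X"
  obtains B where "B > 0" "\<And>x. x \<in> topspace X \<Longrightarrow> \<bar>f x\<bar> \<le> B"
proof -
  obtain B where "\<forall>x\<in>f ` topspace X. norm x \<le> B"
    using assms by (auto simp: bounded_continuous_def bounded_iff)
  then have "\<And>x. x \<in> topspace X \<Longrightarrow> \<bar>f x\<bar> \<le> max B 1" by fastforce
  then show thesis using that[of "max B 1"] by simp
qed

lemma bounded_continuousI:
  assumes "continuous_map X euclideanreal f" "\<And>x. x \<in> topspace X \<Longrightarrow> \<bar>f x\<bar> \<le> B"
  shows "f \<in> bounded_continuous X"
  using assms by (auto simp: bounded_continuous_def bounded_iff intro!: exI[of _ B])

lemma bounded_continuous_uminus:
  "f \<in> bounded_continuous X \<Longrightarrow> (\<lambda>x. - f x) \<in> bounded_continuous X"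
  by (auto simp: bounded_continuous_def bounded_iff)

lemma empirical_measure_eq_distr:
  assumes z: "range z \<subseteq> topspace X" and n: "n > 0"
  shows "empirical_measure X z n = distr (uniform_count_measure {..<n}) (borel_of X) z"
proof (rule measure_eqI)
  show "sets (empirical_measure X z n) = sets (distr (uniform_count_measure {..<n}) (borel_of X) z)"
    by simp
  fix B assume "B \<in> sets (empirical_measure X z n)"
  then have B: "B \<in> sets (borel_of X)" by simp
  have m: "z \<in> measurable (uniform_count_measure {..<n}) (borel_of X)"
    using z by (auto simp: measurable_def sets_uniform_count_measure space_uniform_count_measure)
  have "emeasure (empirical_measure X z n) B = (\<Sum>i<n. indicator B (z i)) / of_nat n"
    using B by (simp add: emeasure_empirical_measure)
  also have "(\<Sum>i<n. indicator B (z i) :: ennreal) = of_nat (card {i. i < n \<and> z i \<in> B})"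
  proof -
    have "{i. i < n \<and> z i \<in> B} = {..<n} \<inter> z -` B" by auto
    then show ?thesis by (simp add: indicator_def vimage_def)
  qed
  also have "of_nat (card {i. i < n \<and> z i \<in> B}) / of_nat n = ennreal (real (card {i. i < n \<and> z i \<in> B}) / real n)"
    using n by (simp add: divide_ennreal[symmetric] ennreal_of_nat_eq_real_of_nat)
  also have "\<dots> = emeasure (uniform_count_measure {..<n}) {i. i < n \<and> z i \<in> B}"
    using n by (subst emeasure_uniform_count_measure) auto
  also have "{i. i < n \<and> z i \<in> B} = z -` B \<inter> space (uniform_count_measure {..<n})"
    by (auto simp: space_uniform_count_measure)
  also have "emeasure (uniform_count_measure {..<n}) \<dots> = emeasure (distr (uniform_count_measure {..<n}) (borel_of X) z) B"
    using B m by (simp add: emeasure_distr)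
  finally show "emeasure (empirical_measure X z n) B = emeasure (distr (uniform_count_measure {..<n}) (borel_of X) z) B" .
qed

lemma integral_empirical_measure:
  assumes "range z \<subseteq> topspace X" "n > 0" "f \<in> borel_measurable (borel_of X)"
  shows "integral\<^sup>L (empirical_measure X z n) f = (\<Sum>i<n. f (z i)) / real n"
proof -
  have "z \<in> measurable (uniform_count_measure {..<n}) (borel_of X)"
    using assms(1) by (auto simp: measurable_def sets_uniform_count_measure space_uniform_count_measure)
  then show ?thesis
    using assms by (simp add: empirical_measure_eq_distr integral_distr integral_uniform_count_measure)
qed

lemma measure_empirical_measure:
  assumes z: "range z \<subseteq> topspace X" and n: "n > 0" and B: "B \<in> sets (borel_of X)"
  shows "measure (empirical_measure X z n) B = real (card {i. i < n \<and> z i \<in> B}) / real n"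
proof -
  have "measure (empirical_measure X z n) B = integral\<^sup>L (empirical_measure X z n) (indicator B)"
    using B sets.sets_into_space[OF B]
    by (simp add: sets_eq_imp_space_eq[OF sets_empirical_measure] Int_absorb2)
  also have "\<dots> = (\<Sum>i<n. indicator B (z i)) / real n"
    using assms by (intro integral_empirical_measure) auto
  also have "(\<Sum>i<n. indicator B (z i) :: real) = real (card {i. i < n \<and> z i \<in> B})"
  proof -
    have "{i. i < n \<and> z i \<in> B} = {..<n} \<inter> z -` B" by auto
    then show ?thesis by (simp add: indicator_def vimage_def)
  qed
  finally show ?thesis .
qed

text \<open>Integrals and measures with respect to the empirical measures are averages and relative frequencies; all later arguments
count points and never return to the empirical measures.\<close>
lemma t_uniformly_distributed_iff:
  assumes H: "Hausdorff_space X"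
  shows "t_uniformly_distributed X M z \<longleftrightarrow> uniformly_distributed X M z \<and> tight_sequence X z"
proof (cases "range z \<subseteq> topspace X")
  case z: True
  have weak: "converges_weakly X (\<lambda>n. empirical_measure X z (Suc n)) M \<longleftrightarrow> uniformly_distributed X M z"
  proof -
    have "integral\<^sup>L (empirical_measure X z (Suc n)) f = (\<Sum>i<Suc n. f (z i)) / real (Suc n)"
      if "f \<in> bounded_continuous X" for f n
      using z that by (intro integral_empirical_measure)
        (auto simp: bounded_continuous_def continuous_map_borel_measurable)
    then have "(\<lambda>n. integral\<^sup>L (empirical_measure X z (Suc n)) f) \<longlonglongrightarrow> integral\<^sup>L M f \<longleftrightarrow>
        (\<lambda>n. (\<Sum>i<n. f (z i)) / real n) \<longlonglongrightarrow> integral\<^sup>L M f"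
      if "f \<in> bounded_continuous X" for f
      using that filterlim_sequentially_Suc[of "\<lambda>n. (\<Sum>i<n. f (z i)) / real n" "nhds (integral\<^sup>L M f)"] by simp
    then show ?thesis
      using z by (auto simp: converges_weakly_def uniformly_distributed_def)
  qed
  have meas: "measure (empirical_measure X z (Suc n)) (topspace X - K) =
      real (card {i. i < Suc n \<and> z i \<notin> K}) / real (Suc n)" if "compactin X K" for K n
  proof -
    have "topspace X - K \<in> sets (borel_of X)"
      using compactin_borel_of[OF H that] by (metis sets.compl_sets space_borel_of)
    moreover have "{i. i < Suc n \<and> z i \<in> topspace X - K} = {i. i < Suc n \<and> z i \<notin> K}"
      using z by auto
    ultimately show ?thesis using measure_empirical_measure[OF z, of "Suc n"] by simp
  qed
  have "uniformly_tight X (\<lambda>n. empirical_measure X z (Suc n)) \<longleftrightarrow> tight_sequence X z"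
  proof
    assume L: "uniformly_tight X (\<lambda>n. empirical_measure X z (Suc n))"
    show "tight_sequence X z"
      unfolding tight_sequence_def
    proof (intro allI impI)
      fix \<epsilon> :: real assume "\<epsilon> > 0"
      then obtain K where K: "compactin X K"
        "\<And>n. measure (empirical_measure X z (Suc n)) (topspace X - K) < \<epsilon>"
        using L by (auto simp: uniformly_tight_def)
      have "real (card {i. i < n \<and> z i \<notin> K}) \<le> \<epsilon> * real n" for n
      proof (cases n)
        case (Suc m)
        then show ?thesis using K(2)[of m] unfolding meas[OF K(1)] by (simp add: divide_simps)
      qed simp
      with K(1) show "\<exists>K. compactin X K \<and> (\<forall>n. real (card {i. i < n \<and> z i \<notin> K}) \<le> \<epsilon> * real n)"
        by blast
    qed
  next
    assume R: "tight_sequence X z"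
    show "uniformly_tight X (\<lambda>n. empirical_measure X z (Suc n))"
      unfolding uniformly_tight_def
    proof (intro allI impI)
      fix \<epsilon> :: real assume e: "\<epsilon> > 0"
      then have "\<epsilon> / 2 > 0" by simp
      then obtain K where K: "compactin X K" "\<And>n. real (card {i. i < n \<and> z i \<notin> K}) \<le> \<epsilon> / 2 * real n"
        using R unfolding tight_sequence_def by meson
      have "measure (empirical_measure X z (Suc n)) (topspace X - K) < \<epsilon>" for n
      proof -
        have "real (card {i. i < Suc n \<and> z i \<notin> K}) / real (Suc n) \<le> \<epsilon> / 2"
          using K(2)[of "Suc n"] by (simp add: divide_simps)
        then show ?thesis unfolding meas[OF K(1)] using e by linarith
      qed
      with K(1) show "\<exists>K. compactin X K \<and> (\<forall>n. measure (empirical_measure X z (Suc n)) (topspace X - K) < \<epsilon>)"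
        by blast
    qed
  qed
  with weak z show ?thesis by (auto simp: t_uniformly_distributed_def)
next
  case False
  then show ?thesis by (simp add: t_uniformly_distributed_def uniformly_distributed_def)
qed

lemma property_ud_iff:
  "property_ud X \<longleftrightarrow> (\<forall>M. radon_measure X M \<and> prob_space M \<longrightarrow> (\<exists>z. ud_sequence False X M z))"
  by (simp add: property_ud_def ud_sequence_def)

lemma property_tud_iff:
  assumes "Hausdorff_space X"
  shows "property_tud X \<longleftrightarrow> (\<forall>M. radon_measure X M \<and> prob_space M \<longrightarrow> (\<exists>z. ud_sequence True X M z))"
  by (simp add: property_tud_def ud_sequence_def t_uniformly_distributed_iff[OF assms])

section \<open>Bisection of measures and interleaving of sequences\<close>

text \<open>The sequence \<open>z l\<close> occupies the places \<open>n\<close> for which \<open>l\<close> is the exponent of \<open>2\<close> in \<open>n + 1\<close>, hence has frequency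
\<open>1 / 2 ^ Suc l\<close>.\<close>

function interleave :: "(nat \<Rightarrow> nat \<Rightarrow> 'a) \<Rightarrow> nat \<Rightarrow> 'a" where
  "interleave z n = (if even n then z 0 (n div 2) else interleave (\<lambda>l. z (Suc l)) (n div 2))"
  by pat_completeness auto
termination
  by (relation "Wellfounded.measure snd") (auto elim: oddE)

declare interleave.simps [simp del]

lemma sum_interleave:
  fixes f :: "'a \<Rightarrow> 'b::comm_monoid_add"
  shows "(\<Sum>i<n. f (interleave z i)) =
    (\<Sum>i<Suc n div 2. f (z 0 i)) + (\<Sum>i<n div 2. f (interleave (\<lambda>l. z (Suc l)) i))"
proof (induction n)
  case 0
  then show ?case by simp
next
  case (Suc n)
  show ?case
  proof (cases "even n")
    case True
    then have "interleave z n = z 0 (n div 2)" "Suc (Suc n) div 2 = Suc (n div 2)" "Suc n div 2 = n div 2"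
      by (auto simp: interleave.simps[of z n])
    then show ?thesis using Suc by (simp add: add_ac)
  next
    case False
    then have "interleave z n = interleave (\<lambda>l. z (Suc l)) (n div 2)" "Suc (Suc n) div 2 = Suc (n div 2)"
        "Suc n div 2 = Suc (n div 2)"
      by (auto simp: interleave.simps[of z n])
    then show ?thesis using Suc by (simp add: add_ac)
  qed
qed

lemma interleave_in: "(\<And>l i. z l i \<in> A) \<Longrightarrow> interleave z n \<in> A"
proof (induction z n rule: interleave.induct)
  case (1 z n)
  then show ?case by (subst interleave.simps) auto
qed

lemma average_eventually_close:
  assumes "(\<lambda>n. (\<Sum>i<n. u i) / real n) \<longlonglongrightarrow> (\<alpha>::real)" and "\<epsilon> > 0"
  shows "eventually (\<lambda>n. \<bar>(\<Sum>i<n. u i) - real n * \<alpha>\<bar> \<le> \<epsilon> * real n) sequentially"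
proof -
  have "eventually (\<lambda>n. dist ((\<Sum>i<n. u i) / real n) \<alpha> < \<epsilon>) sequentially"
    using assms by (rule tendstoD)
  then show ?thesis
    using eventually_gt_at_top[of 0]
  proof eventually_elim
    case (elim n)
    have "(\<Sum>i<n. u i) - real n * \<alpha> = real n * ((\<Sum>i<n. u i) / real n - \<alpha>)"
      using elim by (simp add: field_simps)
    then have "\<bar>(\<Sum>i<n. u i) - real n * \<alpha>\<bar> = real n * \<bar>(\<Sum>i<n. u i) / real n - \<alpha>\<bar>"
      by (simp add: abs_mult)
    also have "\<dots> \<le> real n * \<epsilon>"
      using elim by (intro mult_left_mono) (auto simp: dist_real_def)
    finally show ?case by (simp add: mult.commute)
  qed
qed

text \<open>The numbers \<open>\<gamma> l\<close> are to be thought of as the integrals of \<open>f\<close> with respect to the remainders of the bisection. Unfolding \<open>L\<close> steps leaves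
a remainder of weight \<open>1 / 2 ^ L\<close>, where the trivial bound by \<open>2 * B\<close> is good enough.\<close>
lemma interleave_average_approx:
  fixes f :: "'a \<Rightarrow> real"
  assumes "\<And>l i. \<bar>f (z l i)\<bar> \<le> B" and "\<And>l. \<bar>\<alpha> l\<bar> \<le> B" and "\<And>l. \<bar>\<gamma> l\<bar> \<le> B"
    and "\<And>l. (\<lambda>n. (\<Sum>i<n. f (z l i)) / real n) \<longlonglongrightarrow> \<alpha> l"
    and "\<And>l. \<alpha> l + \<gamma> (Suc l) = 2 * \<gamma> l" and "\<epsilon> > 0"
  shows "eventually (\<lambda>n. \<bar>(\<Sum>i<n. f (interleave z i)) - real n * \<gamma> 0\<bar> \<le> (2 * B / 2 ^ L + \<epsilon>) * real n) sequentially"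
  using assms
proof (induction L arbitrary: z \<alpha> \<gamma> \<epsilon>)
  case 0
  have "\<bar>(\<Sum>i<n. f (interleave z i)) - real n * \<gamma> 0\<bar> \<le> (2 * B / 2 ^ 0 + \<epsilon>) * real n" for n
  proof -
    have "interleave z i \<in> {x. \<bar>f x\<bar> \<le> B}" for i
      by (rule interleave_in) (use 0(1) in auto)
    then have "\<bar>\<Sum>i<n. f (interleave z i)\<bar> \<le> (\<Sum>i<n. B)"
      by (intro order_trans[OF sum_abs] sum_mono) auto
    moreover have "\<bar>real n * \<gamma> 0\<bar> \<le> real n * B"
      using 0(3)[of 0] by (simp add: abs_mult mult_left_mono)
    moreover have "0 \<le> \<epsilon> * real n" using \<open>\<epsilon> > 0\<close> by simp
    ultimately show ?thesis by (simp add: algebra_simps)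
  qed
  then show ?case by simp
next
  case (Suc L)
  have B: "B \<ge> 0" using Suc.prems(2)[of 0] by linarith
  have lim1: "filterlim (\<lambda>n. Suc n div 2) at_top sequentially"
    unfolding filterlim_at_top eventually_sequentially
    by (metis Suc_1 div_le_mono le_SucI nonzero_mult_div_cancel_left old.nat.distinct(2))
  have lim2: "filterlim (\<lambda>n::nat. n div 2) at_top sequentially"
    unfolding filterlim_at_top eventually_sequentially
    by (metis Suc_1 div_le_mono nonzero_mult_div_cancel_left old.nat.distinct(2))
  let ?e = "\<epsilon> / 4"
  have "eventually (\<lambda>n. \<bar>(\<Sum>i<n. f (interleave (\<lambda>l. z (Suc l)) i)) - real n * \<gamma> (Suc 0)\<bar> \<le> (2 * B / 2 ^ L + ?e) * real n) sequentially"
    using Suc.prems by (intro Suc.IH[where \<alpha>="\<lambda>l. \<alpha> (Suc l)" and \<gamma>="\<lambda>l. \<gamma> (Suc l)"]) auto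
  then have ev2: "eventually (\<lambda>n. \<bar>(\<Sum>i<n div 2. f (interleave (\<lambda>l. z (Suc l)) i)) - real (n div 2) * \<gamma> (Suc 0)\<bar>
      \<le> (2 * B / 2 ^ L + ?e) * real (n div 2)) sequentially"
    by (rule eventually_compose_filterlim[OF _ lim2])
  have "eventually (\<lambda>n. \<bar>(\<Sum>i<n. f (z 0 i)) - real n * \<alpha> 0\<bar> \<le> ?e * real n) sequentially"
    using Suc.prems by (intro average_eventually_close) auto
  then have ev1: "eventually (\<lambda>n. \<bar>(\<Sum>i<Suc n div 2. f (z 0 i)) - real (Suc n div 2) * \<alpha> 0\<bar> \<le> ?e * real (Suc n div 2)) sequentially"
    by (rule eventually_compose_filterlim[OF _ lim1])
  obtain N :: nat where N: "B \<le> ?e * real N"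
    using reals_Archimedean3[of ?e] Suc.prems(6) by (auto simp: mult.commute intro: less_imp_le)
  show ?case
    using ev1 ev2 eventually_ge_at_top[of N] eventually_gt_at_top[of 0]
  proof eventually_elim
    case (elim n)
    define a b where "a = real (Suc n div 2)" and "b = real (n div 2)"
    have ab: "real n / 2 \<le> a" "a \<le> (real n + 1) / 2" "b \<le> real n / 2" "(real n - 1) / 2 \<le> b" "a \<le> real n"
      unfolding a_def b_def using elim(4)
      by (cases "even n"; auto elim!: evenE oddE simp: field_simps)+
    have a0: "\<bar>(a - real n / 2) * \<alpha> 0\<bar> \<le> (1/2) * B" "\<bar>(b - real n / 2) * \<gamma> (Suc 0)\<bar> \<le> (1/2) * B"
      unfolding abs_mult using ab Suc.prems(2)[of 0] Suc.prems(3)[of "Suc 0"]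
      by (intro mult_mono; auto)+
    have "real n * \<gamma> 0 = real n / 2 * \<alpha> 0 + real n / 2 * \<gamma> (Suc 0)"
    proof -
      have "\<gamma> 0 = (\<alpha> 0 + \<gamma> (Suc 0)) / 2" using Suc.prems(5)[of 0] by simp
      then show ?thesis by (simp add: field_simps)
    qed
    then have "\<bar>(\<Sum>i<n. f (interleave z i)) - real n * \<gamma> 0\<bar> \<le>
       \<bar>(\<Sum>i<Suc n div 2. f (z 0 i)) - a * \<alpha> 0\<bar> + \<bar>(\<Sum>i<n div 2. f (interleave (\<lambda>l. z (Suc l)) i)) - b * \<gamma> (Suc 0)\<bar>
       + \<bar>(a - real n / 2) * \<alpha> 0\<bar> + \<bar>(b - real n / 2) * \<gamma> (Suc 0)\<bar>"
      unfolding sum_interleave[of f z n] left_diff_distrib by linarith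
    also have "\<dots> \<le> ?e * a + (2 * B / 2 ^ L + ?e) * b + B"
      using elim a0 unfolding a_def b_def by linarith
    also have "\<dots> \<le> ?e * real n + (2 * B / 2 ^ L + ?e) * (real n / 2) + ?e * real n"
    proof (intro add_mono mult_left_mono)
      show "B \<le> \<epsilon> / 4 * real n"
      proof -
        have "?e * real N \<le> ?e * real n" using elim Suc.prems(6) by (intro mult_left_mono) auto
        with N show ?thesis by linarith
      qed
    qed (use ab B Suc.prems(6) in auto)
    also have "\<dots> \<le> (2 * B / 2 ^ Suc L + \<epsilon>) * real n"
      using Suc.prems(6) by (simp add: field_simps)
    finally show ?case .
  qed
qed

text \<open>Only the first \<open>L\<close> sequences are controlled by compact sets, finitely many of which have a compact union; the
others occupy a fraction of at most \<open>1 / 2 ^ L\<close> of every initial segment.\<close>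
lemma interleave_count_bound:
  assumes "\<And>l. tight_sequence X (z l)" and "\<epsilon> > 0"
  shows "\<exists>K. compactin X K \<and> (\<forall>n. real (card {i. i < n \<and> interleave z i \<notin> K}) \<le> (\<epsilon> + 1 / 2 ^ L) * real n)"
  using assms(1)
proof (induction L arbitrary: z)
  case 0
  have "real (card {i. i < n \<and> interleave z i \<notin> {}}) \<le> (\<epsilon> + 1 / 2 ^ 0) * real n" for n
    using \<open>\<epsilon> > 0\<close> by (simp add: algebra_simps)
  then show ?case by (intro exI[of _ "{}"]) auto
next
  case (Suc L)
  obtain K where K: "compactin X K"
    "\<And>n. real (card {i. i < n \<and> interleave (\<lambda>l. z (Suc l)) i \<notin> K}) \<le> (\<epsilon> + 1 / 2 ^ L) * real n"
    using Suc.IH[of "\<lambda>l. z (Suc l)"] Suc.prems by blast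
  have "\<epsilon> / 2 > 0" using \<open>\<epsilon> > 0\<close> by simp
  then obtain K0 where K0: "compactin X K0" "\<And>n. real (card {i. i < n \<and> z 0 i \<notin> K0}) \<le> \<epsilon> / 2 * real n"
    using Suc.prems[of 0] unfolding tight_sequence_def by meson
  have card_eq: "card {i. i < n \<and> y i \<notin> A} = (\<Sum>i<n. of_bool (y i \<notin> A))" for n :: nat and y :: "nat \<Rightarrow> 'a" and A
  proof -
    have "{i. i < n \<and> y i \<notin> A} = {..<n} \<inter> {i. y i \<notin> A}" by auto
    then show ?thesis by simp
  qed
  have "real (card {i. i < n \<and> interleave z i \<notin> K0 \<union> K}) \<le> (\<epsilon> + 1 / 2 ^ Suc L) * real n" for n
  proof -
    have mono: "card {i. i < m \<and> y i \<notin> K0 \<union> K} \<le> card {i. i < m \<and> y i \<notin> A}"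
      if "A = K0 \<or> A = K" for y :: "nat \<Rightarrow> 'a" and m :: nat and A
      using that by (intro card_mono finite_subset[OF _ finite_lessThan[of m]]) auto
    have "card {i. i < n \<and> interleave z i \<notin> K0 \<union> K} = card {i. i < Suc n div 2 \<and> z 0 i \<notin> K0 \<union> K}
        + card {i. i < n div 2 \<and> interleave (\<lambda>l. z (Suc l)) i \<notin> K0 \<union> K}"
      unfolding card_eq by (rule sum_interleave)
    also have "\<dots> \<le> card {i. i < Suc n div 2 \<and> z 0 i \<notin> K0} + card {i. i < n div 2 \<and> interleave (\<lambda>l. z (Suc l)) i \<notin> K}"
      by (intro add_mono mono) auto
    finally have "real (card {i. i < n \<and> interleave z i \<notin> K0 \<union> K}) \<le>
        real (card {i. i < Suc n div 2 \<and> z 0 i \<notin> K0}) + real (card {i. i < n div 2 \<and> interleave (\<lambda>l. z (Suc l)) i \<notin> K})"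
      by linarith
    also have "\<dots> \<le> \<epsilon> / 2 * real (Suc n div 2) + (\<epsilon> + 1 / 2 ^ L) * real (n div 2)"
      by (intro add_mono K K0)
    also have "\<dots> \<le> \<epsilon> / 2 * real n + (\<epsilon> + 1 / 2 ^ L) * (real n / 2)"
    proof (intro add_mono mult_left_mono)
      show "real (Suc n div 2) \<le> real n" by (cases n) auto
    qed (use \<open>\<epsilon> > 0\<close> in auto)
    also have "\<dots> = (\<epsilon> + 1 / 2 ^ Suc L) * real n" by (simp add: field_simps)
    finally show ?thesis .
  qed
  then show ?case using K0 K by (intro exI[of _ "K0 \<union> K"]) (auto intro: compactin_Un)
qed

lemma tight_sequence_interleave:
  assumes "\<And>l. tight_sequence X (z l)"
  shows "tight_sequence X (interleave z)"
  unfolding tight_sequence_def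
proof (intro allI impI)
  fix \<epsilon> :: real assume e: "\<epsilon> > 0"
  obtain L where L: "(1/2 :: real) ^ L < \<epsilon> / 2"
    using real_arch_pow_inv[of "\<epsilon> / 2" "1/2"] e by auto
  obtain K where K: "compactin X K"
    "\<And>n. real (card {i. i < n \<and> interleave z i \<notin> K}) \<le> (\<epsilon> / 2 + 1 / 2 ^ L) * real n"
    using interleave_count_bound[where z=z and X=X and \<epsilon>="\<epsilon> / 2" and L=L] assms e by auto
  have "(\<epsilon> / 2 + 1 / 2 ^ L) * real n \<le> \<epsilon> * real n" for n
    using L by (intro mult_right_mono) (auto simp: power_one_over)
  with K show "\<exists>K. compactin X K \<and> (\<forall>n. real (card {i. i < n \<and> interleave z i \<notin> K}) \<le> \<epsilon> * real n)"
    by (meson order_trans)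
qed

lemma prob_integral_bound:
  assumes "prob_space M" "\<And>x. x \<in> space M \<Longrightarrow> \<bar>f x\<bar> \<le> B" "B \<ge> 0"
  shows "\<bar>integral\<^sup>L M f\<bar> \<le> (B::real)"
proof -
  interpret prob_space M by fact
  have "norm (integral\<^sup>L M f) \<le> integral\<^sup>L M (\<lambda>x. norm (f x))" by (rule integral_norm_bound)
  also have "\<dots> \<le> integral\<^sup>L M (\<lambda>x. B)"
    using assms by (intro integral_mono') auto
  finally show ?thesis by (simp add: prob_space)
qed

text \<open>Dividing by the fixed weight \<open>1/2\<close>, instead of exhausting \<open>M\<close> by disjoint sets of varying mass, gives the
sequences fixed frequencies and keeps the remainder a probability measure at every step.\<close>
lemma ud_sequence_by_halving:
  assumes half: "\<And>M. radon_measure X M \<Longrightarrow> prob_space M \<Longrightarrow>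
      \<exists>M1 M2. radon_measure X M1 \<and> prob_space M1 \<and> radon_measure X M2 \<and> prob_space M2 \<and>
        (\<exists>z. ud_sequence t X M1 z) \<and>
        (\<forall>f\<in>bounded_continuous X. integral\<^sup>L M f = (integral\<^sup>L M1 f + integral\<^sup>L M2 f) / 2)"
    and M: "radon_measure X M" "prob_space M"
  shows "\<exists>z. ud_sequence t X M z"
proof -
  define P where "P N \<longleftrightarrow> radon_measure X N \<and> prob_space N" for N
  define R where "R N N1 N2 \<longleftrightarrow> P N1 \<and> P N2 \<and> (\<exists>z. ud_sequence t X N1 z) \<and>
        (\<forall>f\<in>bounded_continuous X. integral\<^sup>L N f = (integral\<^sup>L N1 f + integral\<^sup>L N2 f) / 2)" for N N1 N2
  have "\<exists>N1 N2. R N N1 N2" if "P N" for N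
    using half[of N] that unfolding P_def R_def by meson
  then obtain F G where FG: "\<And>N. P N \<Longrightarrow> R N (F N) (G N)" by metis
  define Q where "Q l = (G ^^ l) M" for l
  define N where "N l = F (Q l)" for l
  have Q: "Q 0 = M" "P (Q l)" for l
  proof -
    show "Q 0 = M" by (simp add: Q_def)
    show "P (Q l)"
    proof (induction l)
      case 0
      then show ?case using M by (simp add: Q_def P_def)
    next
      case (Suc l)
      then show ?case using FG[of "Q l"] by (simp add: Q_def R_def)
    qed
  qed
  have R: "R (Q l) (N l) (Q (Suc l))" for l
    using FG[OF Q(2)[of l]] by (simp add: N_def Q_def)
  then have "\<exists>z. \<forall>l. ud_sequence t X (N l) (z l)"
    unfolding R_def by (intro choice) blast
  then obtain z where z: "\<And>l. ud_sequence t X (N l) (z l)" by blast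
  have N: "P (N l)" "f \<in> bounded_continuous X \<Longrightarrow> integral\<^sup>L (Q l) f = (integral\<^sup>L (N l) f + integral\<^sup>L (Q (Suc l)) f) / 2" for l f
    using R[of l] unfolding R_def by blast+
  have zin: "z l i \<in> topspace X" for l i
    using z[of l] by (auto simp: ud_sequence_def uniformly_distributed_def)
  have sp: "space K = topspace X" if "P K" for K
    using that unfolding P_def by (metis radon_measure_def sets_eq_imp_space_eq space_borel_of)
  have "(\<lambda>n. (\<Sum>i<n. f (interleave z i)) / real n) \<longlonglongrightarrow> integral\<^sup>L M f" if f: "f \<in> bounded_continuous X" for f
  proof (rule tendstoI)
    fix \<epsilon> :: real assume e: "\<epsilon> > 0"
    obtain B where B: "B > 0" "\<And>x. x \<in> topspace X \<Longrightarrow> \<bar>f x\<bar> \<le> B"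
      using bounded_continuous_bound[OF f] by blast
    obtain L where L: "(1/2 :: real) ^ L < \<epsilon> / (4 * B)"
      using real_arch_pow_inv[of "\<epsilon> / (4 * B)" "1/2"] e B by auto
    have L': "2 * B / 2 ^ L < \<epsilon> / 2"
      using L B by (simp add: field_simps)
    have "eventually (\<lambda>n. \<bar>(\<Sum>i<n. f (interleave z i)) - real n * integral\<^sup>L (Q 0) f\<bar> \<le> (2 * B / 2 ^ L + \<epsilon> / 2) * real n) sequentially"
    proof (rule interleave_average_approx[where \<alpha>="\<lambda>l. integral\<^sup>L (N l) f"])
      show "\<bar>integral\<^sup>L (N l) f\<bar> \<le> B" for l
        using B N(1)[of l] sp[of "N l"] by (intro prob_integral_bound) (auto simp: P_def)
      show "\<bar>integral\<^sup>L (Q l) f\<bar> \<le> B" for l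
        using B Q(2)[of l] sp[of "Q l"] by (intro prob_integral_bound) (auto simp: P_def)
      show "integral\<^sup>L (N l) f + integral\<^sup>L (Q (Suc l)) f = 2 * integral\<^sup>L (Q l) f" for l
        using N(2)[OF f, of l] by simp
      show "(\<lambda>n. (\<Sum>i<n. f (z l i)) / real n) \<longlonglongrightarrow> integral\<^sup>L (N l) f" for l
        using z[of l] f by (auto simp: ud_sequence_def uniformly_distributed_def)
    qed (use zin B e in auto)
    then show "eventually (\<lambda>n. dist ((\<Sum>i<n. f (interleave z i)) / real n) (integral\<^sup>L M f) < \<epsilon>) sequentially"
      using eventually_gt_at_top[of 0]
    proof eventually_elim
      case (elim n)
      have "\<bar>(\<Sum>i<n. f (interleave z i)) / real n - integral\<^sup>L M f\<bar> = \<bar>(\<Sum>i<n. f (interleave z i)) - real n * integral\<^sup>L M f\<bar> / real n"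
        using elim(2) by (simp add: field_simps)
      also have "\<dots> \<le> (2 * B / 2 ^ L + \<epsilon> / 2) * real n / real n"
        using elim by (intro divide_right_mono) (auto simp: Q(1))
      also have "\<dots> < \<epsilon>" using elim L' by simp
      finally show ?case by (simp add: dist_real_def)
    qed
  qed
  moreover have "range (interleave z) \<subseteq> topspace X" using interleave_in[of z "topspace X"] zin by blast
  moreover have "t \<longrightarrow> tight_sequence X (interleave z)"
    using z tight_sequence_interleave by (auto simp: ud_sequence_def)
  ultimately show ?thesis unfolding ud_sequence_def uniformly_distributed_def by blast
qed

section \<open>Radon measures and Lusin's theorem\<close>

lemma compact_metrizable_imp_second_countable:
  assumes "compact_space X" "metrizable_space X"
  shows "second_countable X"
proof -
  obtain M d where "Metric_space M d" and X: "X = Metric_space.mtopology M d"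
    using assms(2) by (auto simp: metrizable_space_def)
  then interpret Metric_space M d by blast
  have "mtotally_bounded M"
    using assms(1) unfolding X compact_space_def by (metis compactin_imp_mtotally_bounded topspace_mtopology)
  then have "\<exists>K. finite K \<and> K \<subseteq> M \<and> M \<subseteq> (\<Union>x\<in>K. mball x (inverse (real (Suc n))))" for n
    unfolding mtotally_bounded_def by (meson inverse_positive_iff_positive of_nat_0_less_iff zero_less_Suc)
  then obtain F where F: "\<And>n. finite (F n)" "\<And>n. F n \<subseteq> M"
    "\<And>n. M \<subseteq> (\<Union>x\<in>F n. mball x (inverse (real (Suc n))))" by metis
  define \<B> where "\<B> = (\<Union>n. (\<lambda>x. mball x (inverse (real (Suc n)))) ` F n)"
  show ?thesis
    unfolding second_countable_def
  proof (intro exI[of _ \<B>] conjI allI impI ballI)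
    show "countable \<B>" using F(1) by (auto simp: \<B>_def countable_finite)
    show "openin X V" if "V \<in> \<B>" for V using that by (auto simp: \<B>_def X)
    fix U x assume "openin X U \<and> x \<in> U"
    then obtain r where r: "r > 0" "mball x r \<subseteq> U" "x \<in> M"
      unfolding X openin_mtopology by blast
    obtain n where n: "inverse (real (Suc n)) < r / 2"
      using reals_Archimedean[of "r / 2"] r by auto
    obtain a where a: "a \<in> F n" "x \<in> mball a (inverse (real (Suc n)))"
      using F(3)[of n] r(3) by blast
    have "mball a (inverse (real (Suc n))) \<subseteq> mball x r"
    proof
      fix y assume "y \<in> mball a (inverse (real (Suc n)))"
      then show "y \<in> mball x r"
        using a n triangle[of x a y] commute[of x a] by auto
    qed
    then show "\<exists>V\<in>\<B>. x \<in> V \<and> V \<subseteq> U"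
      using a r(2) by (intro bexI[of _ "mball a (inverse (real (Suc n)))"]) (auto simp: \<B>_def)
  qed
qed

lemma second_countable_sequence:
  assumes "second_countable X"
  shows "\<exists>U :: nat \<Rightarrow> 'a set. (\<forall>n. openin X (U n)) \<and>
    (\<forall>W x. openin X W \<longrightarrow> x \<in> W \<longrightarrow> (\<exists>n. x \<in> U n \<and> U n \<subseteq> W))"
proof -
  obtain \<B> where \<B>: "countable \<B>" "\<And>V. V \<in> \<B> \<Longrightarrow> openin X V"
    "\<And>U x. openin X U \<Longrightarrow> x \<in> U \<Longrightarrow> \<exists>V \<in> \<B>. x \<in> V \<and> V \<subseteq> U"
    using assms unfolding second_countable_def by metis
  let ?U = "from_nat_into (insert {} \<B>)"
  have ran: "range ?U = insert {} \<B>"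
    using \<B>(1) by (intro range_from_nat_into) auto
  show ?thesis
  proof (intro exI[of _ ?U] conjI allI impI)
    show "openin X (?U n)" for n using ran \<B>(2) by (metis insertE openin_empty rangeI)
    show "\<exists>n. x \<in> ?U n \<and> ?U n \<subseteq> W" if "openin X W" "x \<in> W" for W x
      using \<B>(3)[OF that] ran by (metis insertCI rangeE)
  qed
qed

lemma radon_measureD:
  assumes "radon_measure X M"
  shows "sets M = sets (borel_of X)" "finite_measure M" "space M = topspace X"
  using assms unfolding radon_measure_def by (auto dest: sets_eq_imp_space_eq)

lemma radon_measure_inner:
  assumes "radon_measure X M" "B \<in> sets (borel_of X)" "\<epsilon> > 0"
  obtains K where "compactin X K" "K \<subseteq> B" "measure M (B - K) < \<epsilon>"
  using assms unfolding radon_measure_def by metis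

lemma radon_measure_density:
  fixes g :: "'a \<Rightarrow> real"
  assumes H: "Hausdorff_space X" and M: "radon_measure X M" and g: "g \<in> borel_measurable M"
    and gb: "\<And>x. x \<in> topspace X \<Longrightarrow> 0 \<le> g x \<and> g x \<le> c"
  shows "radon_measure X (density M (\<lambda>x. ennreal (g x)))"
proof -
  note D = radon_measureD[OF M]
  interpret finite_measure M by (rule D)
  \<comment> \<open>The maximum makes \<open>c'\<close> positive also when the space is empty and \<open>c\<close> is arbitrary.\<close>
  define c' where "c' = max c 1"
  have le: "emeasure (density M g) A \<le> ennreal c' * emeasure M A" if "A \<in> sets M" for A
  proof -
    have "emeasure (density M g) A = (\<integral>\<^sup>+x. ennreal (g x) * indicator A x \<partial>M)"
      using g that by (intro emeasure_density) auto
    also have "\<dots> \<le> (\<integral>\<^sup>+x. ennreal c' * indicator A x \<partial>M)"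
      using gb by (intro nn_integral_mono mult_right_mono) (auto simp: c'_def D max.coboundedI1 intro!: ennreal_leI)
    also have "\<dots> = ennreal c' * emeasure M A"
      using that by (simp add: nn_integral_cmult_indicator)
    finally show ?thesis .
  qed
  have fin: "finite_measure (density M g)"
  proof
    have "emeasure (density M g) (space M) \<le> ennreal c' * emeasure M (space M)" by (intro le) auto
    also have "\<dots> < \<infinity>" by (simp add: emeasure_eq_measure ennreal_mult_less_top)
    finally show "emeasure (density M g) (space (density M g)) \<noteq> \<infinity>" by simp
  qed
  have lem: "measure (density M g) A \<le> c' * measure M A" if "A \<in> sets M" for A
  proof -
    have "ennreal (measure (density M g) A) \<le> ennreal (c' * measure M A)"
      using le[OF that] finite_measure.emeasure_eq_measure[OF fin, of A] emeasure_eq_measure[of A]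
      by (simp add: ennreal_mult c'_def)
    then show ?thesis by (simp add: c'_def)
  qed
  show ?thesis
    unfolding radon_measure_def
  proof (intro conjI ballI allI impI)
    show "sets (density M g) = sets (borel_of X)" by (simp add: D)
    show "finite_measure (density M g)" by (rule fin)
    fix B and \<epsilon> :: real assume B: "B \<in> sets (density M g)" and e: "\<epsilon> > 0"
    have "\<epsilon> / c' > 0" using e by (simp add: c'_def)
    then obtain K where K: "compactin X K" "K \<subseteq> B" "measure M (B - K) < \<epsilon> / c'"
      using radon_measure_inner[OF M, of B "\<epsilon> / c'"] B D(1) by auto
    have "B - K \<in> sets M" using B compactin_borel_of[OF H K(1)] by (auto simp: D)
    then have "measure (density M g) (B - K) \<le> c' * measure M (B - K)" by (rule lem)
    also have "\<dots> < \<epsilon>" using K(3) by (simp add: c'_def field_simps)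
    finally show "\<exists>K. compactin X K \<and> K \<subseteq> B \<and> measure (density M g) (B - K) < \<epsilon>" using K by blast
  qed
qed

lemma radon_measure_distr:
  assumes H: "Hausdorff_space X" "Hausdorff_space Y" and M: "radon_measure X M" and f: "continuous_map X Y f"
  shows "radon_measure Y (distr M (borel_of Y) f)"
proof -
  note D = radon_measureD[OF M]
  interpret finite_measure M by (rule D)
  have fm: "f \<in> measurable M (borel_of Y)"
    using continuous_map_measurable[OF f] by (simp add: measurable_cong_sets[OF D(1) refl])
  show ?thesis
    unfolding radon_measure_def
  proof (intro conjI ballI allI impI)
    show "sets (distr M (borel_of Y) f) = sets (borel_of Y)" by simp
    show "finite_measure (distr M (borel_of Y) f)" using fm by (rule finite_measure_distr)
    fix B and \<epsilon> :: real assume "B \<in> sets (distr M (borel_of Y) f)" and e: "\<epsilon> > 0"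
    then have B: "B \<in> sets (borel_of Y)" by simp
    have "f -` B \<inter> space M \<in> sets (borel_of X)" using measurable_sets[OF fm B] by (simp add: D)
    then obtain K where K: "compactin X K" "K \<subseteq> f -` B \<inter> space M" "measure M (f -` B \<inter> space M - K) < \<epsilon>"
      using radon_measure_inner[OF M _ e] by metis
    have cK: "compactin Y (f ` K)" using K(1) f by (rule image_compactin)
    have BK: "B - f ` K \<in> sets (borel_of Y)" using B compactin_borel_of[OF H(2) cK] by auto
    have "measure (distr M (borel_of Y) f) (B - f ` K) = measure M (f -` (B - f ` K) \<inter> space M)"
      using fm BK by (rule measure_distr)
    also have "\<dots> \<le> measure M (f -` B \<inter> space M - K)"
    proof (rule finite_measure_mono)
      show "f -` B \<inter> space M - K \<in> sets M" using measurable_sets[OF fm B] compactin_borel_of[OF H(1) K(1)] by (simp add: D sets.Diff)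
    qed auto
    also note K(3)
    finally show "\<exists>K. compactin Y K \<and> K \<subseteq> B \<and> measure (distr M (borel_of Y) f) (B - K) < \<epsilon>"
      using cK K(2) by (intro exI[of _ "f ` K"]) auto
  qed
qed

lemma prob_space_density_real:
  fixes g :: "'a \<Rightarrow> real"
  assumes "integrable M g" "\<And>x. x \<in> space M \<Longrightarrow> 0 \<le> g x" "integral\<^sup>L M g = 1"
  shows "prob_space (density M (\<lambda>x. ennreal (g x)))"
proof
  have "emeasure (density M (\<lambda>x. ennreal (g x))) (space (density M (\<lambda>x. ennreal (g x)))) = (\<integral>\<^sup>+x. ennreal (g x) \<partial>M)"
    using assms(1) by (subst emeasure_density) (auto intro!: nn_integral_cong)
  also have "\<dots> = ennreal (integral\<^sup>L M g)"
    using assms by (intro nn_integral_eq_integral) auto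
  finally show "emeasure (density M (\<lambda>x. ennreal (g x))) (space (density M (\<lambda>x. ennreal (g x)))) = 1"
    using assms(3) by simp
qed

definition conditional_measure :: "'a measure \<Rightarrow> 'a set \<Rightarrow> 'a measure" where
  "conditional_measure M A = density M (\<lambda>x. ennreal (indicator A x / measure M A))"

text \<open>As \<open>A\<close> has at least half of the mass, the density \<open>indicator A / measure M A\<close> is at most \<open>2\<close>, and \<open>2\<close> minus it is the
density of the other half.\<close>
lemma radon_halving:
  assumes H: "Hausdorff_space X" and M: "radon_measure X M" "prob_space M"
    and A: "A \<in> sets M" "measure M A \<ge> 1/2"
  shows "radon_measure X (conditional_measure M A) \<and> prob_space (conditional_measure M A) \<and>
    (\<exists>M2. radon_measure X M2 \<and> prob_space M2 \<and>
      (\<forall>f\<in>bounded_continuous X. integral\<^sup>L M f = (integral\<^sup>L (conditional_measure M A) f + integral\<^sup>L M2 f) / 2))"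
proof -
  note D = radon_measureD[OF M(1)]
  interpret prob_space M by (rule M(2))
  define g where "g = (\<lambda>x. indicator A x / measure M A)"
  define h where "h = (\<lambda>x. 2 - g x)"
  have gb: "0 \<le> g x" "g x \<le> 2" for x
    using A(2) by (auto simp: g_def indicator_def field_simps)
  have gm [measurable]: "g \<in> borel_measurable M" using A(1) by (simp add: g_def)
  have hm [measurable]: "h \<in> borel_measurable M" by (simp add: h_def)
  have ig: "integrable M g" using gb by (intro integrable_const_bound[of _ 2]) auto
  have ih: "integrable M h" using gb by (intro integrable_const_bound[of _ 2]) (auto simp: h_def)
  have Ig: "integral\<^sup>L M g = 1" using A by (simp add: g_def)
  have Ih: "integral\<^sup>L M h = 1" using ig Ig by (simp add: h_def prob_space)
  have cond: "conditional_measure M A = density M g" by (simp add: conditional_measure_def g_def)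
  have "radon_measure X (density M g)" "radon_measure X (density M h)"
    using H M gb by (auto intro!: radon_measure_density[where c=2] simp: h_def)
  moreover have "prob_space (density M g)" "prob_space (density M h)"
    using ig ih Ig Ih gb by (auto intro!: prob_space_density_real simp: h_def)
  moreover have "integral\<^sup>L M f = (integral\<^sup>L (density M g) f + integral\<^sup>L (density M h) f) / 2"
    if f: "f \<in> bounded_continuous X" for f
  proof -
    have [measurable]: "f \<in> borel_measurable M"
      using f by (auto simp: bounded_continuous_def D cong: measurable_cong_sets intro: continuous_map_borel_measurable)
    obtain B where B: "B > 0" "\<And>x. x \<in> topspace X \<Longrightarrow> \<bar>f x\<bar> \<le> B"
      using bounded_continuous_bound[OF f] by blast
    have "integrable M (\<lambda>x. g x * f x)" 
      using B gb by (intro integrable_const_bound[of _ "2 * B"]) (auto simp: D abs_mult intro!: mult_mono AE_I2)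
    moreover have "integrable M f"
      using B by (intro integrable_const_bound[of _ "B"]) (auto simp: D intro!: AE_I2)
    moreover have "integral\<^sup>L (density M g) f = integral\<^sup>L M (\<lambda>x. g x * f x)"
      using gb by (subst integral_density) auto
    moreover have "integral\<^sup>L (density M h) f = integral\<^sup>L M (\<lambda>x. 2 * f x - g x * f x)"
      using gb by (subst integral_density) (auto simp: h_def algebra_simps)
    ultimately show ?thesis by simp
  qed
  ultimately show ?thesis unfolding cond by blast
qed

text \<open>Lusin's theorem, simultaneously for countably many functions. For each preimage \<open>S m\<close> of a basic open set, inner regularity yields disjoint compact sets
\<open>Q m\<close> in \<open>S m\<close> and \<open>Q' m\<close> in its complement; on the intersection \<open>K\<close> of the sets \<open>Q m \<union> Q' m\<close>, all
these preimages are relatively open.\<close>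
lemma radon_lusin:
  fixes p :: "'i::countable \<Rightarrow> 'a \<Rightarrow> real"
  assumes H: "Hausdorff_space X" and M: "radon_measure X M"
    and p: "\<And>i. p i \<in> borel_measurable M" and e: "\<epsilon> > 0"
  obtains K where "compactin X K" "measure M (topspace X - K) < \<epsilon>"
    "\<And>i. continuous_map (subtopology X K) euclideanreal (p i)"
proof -
  note D = radon_measureD[OF M]
  interpret finite_measure M by (rule D)
  obtain V :: "nat \<Rightarrow> real set" where V: "\<And>n. openin euclideanreal (V n)"
    "\<And>W x. openin euclideanreal W \<Longrightarrow> x \<in> W \<Longrightarrow> \<exists>n. x \<in> V n \<and> V n \<subseteq> W"
  proof -
    have "second_countable euclideanreal"
      unfolding second_countable_def using ex_countable_basis[where 'a=real]
      by (metis open_openin topological_basisE topological_basis_open)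
    from second_countable_sequence[OF this] show ?thesis using that by metis
  qed
  define S where "S m = (case from_nat m of (i, n) \<Rightarrow> p i -` V n \<inter> space M)" for m
  have S: "S m \<in> sets M" for m
    using p V(1) by (auto simp: S_def split: prod.splits intro!: measurable_sets)
  \<comment> \<open>The set lost at stage \<open>m\<close> has two parts of measure at most \<open>d m\<close>; in total this is \<open>\<epsilon> / 2\<close>.\<close>
  define d where "d m = \<epsilon> / 2 * (1/2) ^ Suc m / 2" for m
  have d: "d m > 0" for m using e by (simp add: d_def)
  have "\<exists>Q Q'. compactin X Q \<and> compactin X Q' \<and> Q \<subseteq> S m \<and> Q' \<subseteq> space M - S m \<and>
      measure M (S m - Q) < d m \<and> measure M (space M - S m - Q') < d m" for m
  proof -
    have s: "S m \<in> sets (borel_of X)" "space M - S m \<in> sets (borel_of X)"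
      using S[of m] sets.compl_sets[OF S[of m]] by (simp_all add: D)
    show ?thesis using radon_measure_inner[OF M s(1) d] radon_measure_inner[OF M s(2) d] by metis
  qed
  then obtain Q Q' where Q: "\<And>m. compactin X (Q m)" "\<And>m. compactin X (Q' m)" "\<And>m. Q m \<subseteq> S m"
    "\<And>m. Q' m \<subseteq> space M - S m" "\<And>m. measure M (S m - Q m) < d m"
    "\<And>m. measure M (space M - S m - Q' m) < d m" by metis
  have Qs: "Q m \<in> sets M" "Q' m \<in> sets M" for m
    using Q(1,2) compactin_borel_of[OF H] by (simp_all add: D)
  define K where "K = (\<Inter>m. Q m \<union> Q' m)"
  show thesis
  proof
    show cK: "compactin X K"
    proof (rule closed_compactin)
      show "compactin X (Q 0 \<union> Q' 0)" using Q by (intro compactin_Un)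
      show "K \<subseteq> Q 0 \<union> Q' 0" by (auto simp: K_def)
      show "closedin X K" unfolding K_def using Q H
        by (intro closedin_Inter) (auto intro!: compactin_imp_closedin compactin_Un)
    qed
    have le: "measure M (space M - (Q m \<union> Q' m)) \<le> \<epsilon> / 2 * (1/2) ^ Suc m" for m
    proof -
      have "measure M (space M - (Q m \<union> Q' m)) \<le> measure M ((S m - Q m) \<union> (space M - S m - Q' m))"
        using S Qs by (intro finite_measure_mono) auto
      also have "\<dots> \<le> measure M (S m - Q m) + measure M (space M - S m - Q' m)"
        using S Qs by (intro measure_Un_le) auto
      also have "\<dots> \<le> d m + d m" using Q(5,6)[of m] by linarith
      finally show ?thesis by (simp add: d_def)
    qed
    have "(\<lambda>m. \<epsilon> / 2 * (1/2) ^ Suc m) sums (\<epsilon> / 2 * 1)"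
      by (intro sums_mult power_half_series)
    then have geo: "summable (\<lambda>m. \<epsilon> / 2 * (1/2) ^ Suc m)" "(\<Sum>m. \<epsilon> / 2 * (1/2) ^ Suc m) = \<epsilon> / 2"
      by (auto simp: sums_iff)
    have sm: "summable (\<lambda>m. measure M (space M - (Q m \<union> Q' m)))"
      by (rule summable_comparison_test'[OF geo(1), of 0]) (use le in auto)
    have "measure M (topspace X - K) = measure M (\<Union>m. space M - (Q m \<union> Q' m))"
      by (rule arg_cong[of _ _ "measure M"]) (auto simp: K_def D)
    also have "\<dots> \<le> (\<Sum>m. measure M (space M - (Q m \<union> Q' m)))"
      using Qs sm by (intro finite_measure_subadditive_countably) auto
    also have "\<dots> \<le> \<epsilon> / 2"
      using suminf_le[OF le sm geo(1)] geo(2) by simp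
    finally show "measure M (topspace X - K) < \<epsilon>" using e by linarith
    fix i
    show "continuous_map (subtopology X K) euclideanreal (p i)"
      unfolding continuous_map_def
    proof (intro conjI allI impI)
      fix W assume W: "openin euclideanreal W"
      show "openin (subtopology X K) {x \<in> topspace (subtopology X K). p i x \<in> W}"
      proof (subst openin_subopen, intro ballI)
        fix x assume "x \<in> {x \<in> topspace (subtopology X K). p i x \<in> W}"
        then have x: "x \<in> topspace X" "x \<in> K" "p i x \<in> W" by auto
        then obtain n where n: "p i x \<in> V n" "V n \<subseteq> W" using V(2)[OF W] by blast
        define m where "m = to_nat (i, n)"
        have Sm: "S m = p i -` V n \<inter> space M" by (simp add: S_def m_def)
        have "openin X (topspace X - Q' m)"
          using compactin_imp_closedin[OF H Q(2)[of m]] by auto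
        then have "openin (subtopology X K) (K \<inter> (topspace X - Q' m))"
          by (auto simp: openin_subtopology)
        moreover have "x \<in> K \<inter> (topspace X - Q' m)"
          using x n Q(4)[of m] by (auto simp: Sm D)
        moreover have "K \<inter> (topspace X - Q' m) \<subseteq> {x \<in> topspace (subtopology X K). p i x \<in> W}"
          using Q(3)[of m] n by (auto simp: Sm K_def)
        ultimately show "\<exists>T. openin (subtopology X K) T \<and> x \<in> T \<and> T \<subseteq> {x \<in> topspace (subtopology X K). p i x \<in> W}"
          by blast
      qed
    qed auto
  qed
qed

text \<open>A Radon-Nikodym derivative with values in \<open>[0,1]\<close> everywhere, so that it can serve as a probability at every point.\<close>
lemma density_fraction:
  assumes M: "finite_measure M" and sets: "sets N = sets M"
    and le: "\<And>A. A \<in> sets M \<Longrightarrow> emeasure N A \<le> emeasure M A"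
  obtains p where "p \<in> borel_measurable M" "\<And>x. 0 \<le> p x \<and> p x \<le> (1::real)"
    "N = density M (\<lambda>x. ennreal (p x))"
proof -
  interpret finite_measure M by fact
  have "absolutely_continuous M N"
    unfolding absolutely_continuous_def using le sets
    by (auto simp: null_sets_def) (metis le_zero_eq)
  then obtain f where f: "f \<in> borel_measurable M" "density M f = N"
    using Radon_Nikodym sets by blast
  note [measurable] = f(1)
  \<comment> \<open>If \<open>f\<close> exceeded \<open>1\<close> on a set of positive measure, \<open>N\<close> would exceed \<open>M\<close> on that set.\<close>
  have "AE x in M. f x \<le> 1"
  proof -
    let ?A = "{x \<in> space M. f x > 1}"
    have A: "?A \<in> sets M" by measurable
    have fA: "(\<integral>\<^sup>+x. f x * indicator ?A x \<partial>M) \<le> (\<integral>\<^sup>+x. indicator ?A x \<partial>M)"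
      using le[OF A] A by (simp add: f(2)[symmetric] emeasure_density)
    have "AE x in M. f x * indicator ?A x \<le> indicator ?A x"
    proof (rule ccontr)
      assume "\<not> (AE x in M. f x * indicator ?A x \<le> indicator ?A x)"
      then have "(\<integral>\<^sup>+x. indicator ?A x \<partial>M) < (\<integral>\<^sup>+x. f x * indicator ?A x \<partial>M)"
      proof (intro nn_integral_less)
        show "(\<integral>\<^sup>+x. indicator ?A x \<partial>M) \<noteq> \<infinity>"
          using A emeasure_finite[of ?A] by simp
        show "AE x in M. indicator ?A x \<le> f x * indicator ?A x"
          by (intro AE_I2) (auto simp: indicator_def)
      qed (use A in auto)
      with fA show False by simp
    qed
    then show ?thesis using AE_space
    proof eventually_elim
      case (elim x)
      then show ?case by (cases "f x > 1") auto
    qed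
  qed
  then have ae: "AE x in M. ennreal (enn2real (min 1 (f x))) = f x"
    by eventually_elim (metis ennreal_enn2real ennreal_one_less_top min.absorb2 order_le_less_trans)
  have "density M (\<lambda>x. ennreal (enn2real (min 1 (f x)))) = N"
    unfolding f(2)[symmetric] by (intro density_cong ae) measurable
  moreover have "enn2real (min 1 (f x)) \<le> 1" for x
    by (metis enn2real_1 enn2real_mono ennreal_one_less_top min.cobounded1)
  ultimately show thesis by (intro that[of "\<lambda>x. enn2real (min 1 (f x))"]) auto
qed

section \<open>The tree of cells of a compact metrizable space\<close>

text \<open>The cells of depth \<open>k\<close> are the atoms of the algebra of subsets of \<open>C\<close> generated by \<open>U 0, \<dots>, U (k - 1)\<close>; some of them may be empty.\<close>
fun cell :: "(nat \<Rightarrow> 'b set) \<Rightarrow> 'b set \<Rightarrow> bool list \<Rightarrow> 'b set" where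
  "cell U C [] = C"
| "cell U C (d # s) = (if d then cell U C s \<inter> U (length s) else cell U C s - U (length s))"

text \<open>A continuous extension of the transition probabilities can lead into empty cells. There the point of the last nonempty
ancestor is kept, so that a point below \<open>s\<close> is never farther from \<open>cell_point U C s\<close> than the cell of \<open>s\<close> is wide.\<close>
fun cell_point :: "(nat \<Rightarrow> 'b set) \<Rightarrow> 'b set \<Rightarrow> bool list \<Rightarrow> 'b" where
  "cell_point U C [] = (SOME y. y \<in> C)"
| "cell_point U C (d # s) =
     (if cell U C (d # s) \<noteq> {} then SOME y. y \<in> cell U C (d # s) else cell_point U C s)"

definition same_cell :: "(nat \<Rightarrow> 'b set) \<Rightarrow> 'b set \<Rightarrow> nat \<Rightarrow> ('b \<times> 'b) set" where
  "same_cell U C k = {(y, y'). y \<in> C \<and> y' \<in> C \<and> (\<forall>i<k. y \<in> U i \<longleftrightarrow> y' \<in> U i)}"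

lemma cell_append: "cell U C (ds @ s) \<subseteq> cell U C s"
  by (induction ds) auto

lemma cell_subset: "cell U C s \<subseteq> C"
  using cell_append[of U C s "[]"] by simp

lemma cell_point_in_cell: "C \<noteq> {} \<Longrightarrow> cell U C s \<noteq> {} \<Longrightarrow> cell_point U C s \<in> cell U C s"
  by (cases s) (auto simp del: cell.simps(2) intro: someI)

lemma cell_point_in: "C \<noteq> {} \<Longrightarrow> cell_point U C s \<in> C"
proof (induction s)
  case (Cons d s)
  show ?case
  proof (cases "cell U C (d # s) = {}")
    case True
    then show ?thesis using Cons by (simp del: cell.simps(2))
  next
    case False
    then show ?thesis using subsetD[OF cell_subset cell_point_in_cell[OF Cons.prems False]] by simp
  qed
qed (auto intro: someI)

lemma cell_point_append:
  assumes "C \<noteq> {}"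
  shows "cell_point U C (ds @ s) = cell_point U C s \<or> cell_point U C (ds @ s) \<in> cell U C s"
proof (induction ds)
  case (Cons d ds)
  then show ?case
    using cell_point_in_cell[OF assms, of U "d # ds @ s"] cell_append[of U C "d # ds" s]
    by (cases "cell U C (d # ds @ s) = {}") (auto simp del: cell.simps(2))
qed simp

lemma cell_mem_agree: "y \<in> cell U C s \<Longrightarrow> y' \<in> cell U C s \<Longrightarrow> i < length s \<Longrightarrow> y \<in> U i \<longleftrightarrow> y' \<in> U i"
  by (induction s) (auto simp: less_Suc_eq split: if_splits)

lemma same_cellI: "y \<in> cell U C s \<Longrightarrow> y' \<in> cell U C s \<Longrightarrow> (y, y') \<in> same_cell U C (length s)"
  using cell_subset[of U C s] cell_mem_agree[of y U C s y'] by (auto simp: same_cell_def)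

lemma cell_point_append_same_cell:
  assumes "C \<noteq> {}"
  shows "(cell_point U C (ds @ s), cell_point U C s) \<in> same_cell U C (length s)"
proof (cases "cell_point U C (ds @ s) = cell_point U C s")
  case True
  then show ?thesis using cell_point_in[OF assms, of U s] by (simp add: same_cell_def)
next
  case False
  then have "cell_point U C (ds @ s) \<in> cell U C s" using cell_point_append[OF assms, of U ds s] by simp
  then show ?thesis using same_cellI[of _ U C s] cell_point_in_cell[OF assms, of U s] by blast
qed

lemma finite_bool_lists: "finite {s :: bool list. length s = k}"
  using finite_lists_length_eq[of "UNIV :: bool set" k] by simp

lemma ex1_cell: "y \<in> C \<Longrightarrow> \<exists>!s. length s = k \<and> y \<in> cell U C s"
proof (induction k)
  case 0
  then show ?case by (intro ex1I[of _ "[]"]) auto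
next
  case (Suc k)
  then obtain s where s: "length s = k" "y \<in> cell U C s" "\<And>s'. length s' = k \<Longrightarrow> y \<in> cell U C s' \<Longrightarrow> s' = s"
    by auto
  show ?case
  proof (rule ex1I[of _ "(y \<in> U k) # s"])
    show "length ((y \<in> U k) # s) = Suc k \<and> y \<in> cell U C ((y \<in> U k) # s)" using s(1,2) by simp
    fix s' assume a: "length s' = Suc k \<and> y \<in> cell U C s'"
    then obtain d r where "s' = d # r" "length r = k" by (cases s') auto
    moreover from this have "r = s" using a s(3)[of r] by (auto split: if_splits)
    ultimately show "s' = (y \<in> U k) # s" using a by (cases d) auto
  qed
qed

lemma sum_indicator_cell:
  assumes "y \<in> C"
  shows "(\<Sum>s | length s = k. indicator (cell U C s) y) = (1::real)"
proof -
  obtain s where s: "length s = k" "y \<in> cell U C s" "\<And>s'. length s' = k \<Longrightarrow> y \<in> cell U C s' \<Longrightarrow> s' = s"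
    using ex1_cell[OF assms, of k U] by auto
  have "(\<Sum>s | length s = k. indicator (cell U C s) y) = (\<Sum>s' | length s' = k. if s' = s then 1 else (0::real))"
  proof (intro sum.cong refl)
    fix s' :: "bool list" assume "s' \<in> {s. length s = k}"
    then have "y \<in> cell U C s' \<longleftrightarrow> s' = s" using s(2,3) by blast
    then show "indicator (cell U C s') y = (if s' = s then 1 else (0::real))"
      by (simp add: indicator_def)
  qed
  then show ?thesis using s(1) finite_bool_lists by simp
qed

text \<open>The walker number \<open>j\<close> is represented by the point of its node at depth \<open>j\<close>, so that one sequence of points serves all
depths \<open>k\<close>. Replacing that node by its ancestor at depth \<open>k\<close> costs \<open>E\<close> for each walker with \<open>j \<ge> k\<close> and \<open>2 * B\<close> for each of the first
\<open>k\<close> walkers; the visits to the nodes of depth \<open>k\<close> are known up to \<open>k\<close>.\<close>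
lemma route_sum_le:
  fixes g :: "'b \<Rightarrow> real"
  assumes p: "\<And>s. 0 \<le> p s \<and> p s \<le> 1" and C: "C \<noteq> {}"
    and B: "\<And>y. y \<in> C \<Longrightarrow> \<bar>g y\<bar> \<le> B"
    and E: "\<And>y y'. (y, y') \<in> same_cell U C k \<Longrightarrow> \<bar>g y - g y'\<bar> \<le> E"
  shows "(\<Sum>j<J. g (cell_point U C (route p j j))) \<le>
    (real (card {s :: bool list. length s = k}) * real k * B + 2 * B * real k) +
    real J * ((\<Sum>s | length s = k. node_prob p s * g (cell_point U C s)) + E)"
proof -
  let ?pt = "cell_point U C" and ?S = "{s :: bool list. length s = k}"
  have gB: "\<bar>g (?pt s)\<bar> \<le> B" for s using B cell_point_in[OF C] by blast
  have B0: "B \<ge> 0" using gB[of "[]"] by linarith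
  have "(?pt (replicate k True), ?pt (replicate k True)) \<in> same_cell U C k"
    using cell_point_append_same_cell[OF C, of U "[]" "replicate k True"] by simp
  then have E0: "E \<ge> 0" using E by fastforce
  have "g (?pt (route p j j)) \<le> g (?pt (route p j k)) + E + of_bool (j < k) * (2 * B)" for j
  proof (cases "j < k")
    case True
    then show ?thesis using gB[of "route p j j"] gB[of "route p j k"] E0 by simp
  next
    case False
    obtain ds where "route p j (k + (j - k)) = ds @ route p j k" using route_add by blast
    then have "route p j j = ds @ route p j k" using False by simp
    then have "(?pt (route p j j), ?pt (route p j k)) \<in> same_cell U C k"
      using cell_point_append_same_cell[OF C, of U ds "route p j k"] by simp
    then show ?thesis using E[of "?pt (route p j j)" "?pt (route p j k)"] False by simp
  qed
  then have "(\<Sum>j<J. g (?pt (route p j j))) \<le> (\<Sum>j<J. g (?pt (route p j k)) + E + of_bool (j < k) * (2 * B))"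
    by (intro sum_mono) auto
  also have "\<dots> = (\<Sum>j<J. g (?pt (route p j k))) + real J * E + real (card ({..<J} \<inter> {j. j < k})) * (2 * B)"
    by (simp add: sum.distrib sum_distrib_right[symmetric])
  also have "real (card ({..<J} \<inter> {j. j < k})) * (2 * B) \<le> 2 * B * real k"
  proof -
    have "card ({..<J} \<inter> {j. j < k}) \<le> card {..<k}" by (intro card_mono) auto
    then show ?thesis using B0 by (simp add: mult.commute mult_left_mono)
  qed
  also have "(\<Sum>j<J. g (?pt (route p j k))) = (\<Sum>j<J. \<Sum>s\<in>?S. of_bool (route p j k = s) * g (?pt s))"
  proof (intro sum.cong refl)
    fix j
    have "(\<Sum>s\<in>?S. of_bool (route p j k = s) * g (?pt s)) = (\<Sum>s\<in>?S. if s = route p j k then g (?pt s) else 0)"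
      by (intro sum.cong) auto
    then show "g (?pt (route p j k)) = (\<Sum>s\<in>?S. of_bool (route p j k = s) * g (?pt s))"
      using finite_bool_lists by simp
  qed
  also have "\<dots> = (\<Sum>s\<in>?S. (\<Sum>j<J. of_bool (route p j k = s)) * g (?pt s))"
    by (subst sum.swap) (simp add: sum_distrib_right)
  also have "\<dots> = (\<Sum>s\<in>?S. real (visits p s J) * g (?pt s))"
    by (intro sum.cong) (auto simp: visits_eq_sum[of p, OF p])
  also have "\<dots> \<le> (\<Sum>s\<in>?S. real J * (node_prob p s * g (?pt s)) + real k * B)"
  proof (intro sum_mono)
    fix s :: "bool list" assume s: "s \<in> ?S"
    have "(real (visits p s J) - real J * node_prob p s) * g (?pt s) \<le>
        \<bar>real (visits p s J) - real J * node_prob p s\<bar> * \<bar>g (?pt s)\<bar>"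
      by (metis abs_ge_self abs_mult)
    also have "\<dots> \<le> real k * B"
      using visits_approx[of p s J] p s gB by (intro mult_mono) auto
    finally show "real (visits p s J) * g (?pt s) \<le> real J * (node_prob p s * g (?pt s)) + real k * B"
      by (simp add: algebra_simps)
  qed
  also have "\<dots> = real J * (\<Sum>s\<in>?S. node_prob p s * g (?pt s)) + real (card ?S) * real k * B"
    by (simp add: sum.distrib sum_distrib_left)
  finally show ?thesis by (simp add: algebra_simps)
qed

definition oscillation ::
    "(nat \<Rightarrow> 'b set) \<Rightarrow> 'b set \<Rightarrow> ('a \<times> 'b \<Rightarrow> real) \<Rightarrow> nat \<Rightarrow> 'a \<Rightarrow> real" where
  "oscillation U C f k x = (SUP q\<in>same_cell U C k. \<bar>f (x, fst q) - f (x, snd q)\<bar>)"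

lemma oscillation_upper:
  assumes B: "\<And>y. y \<in> C \<Longrightarrow> \<bar>f (x, y)\<bar> \<le> B" and "(y, y') \<in> same_cell U C k"
  shows "\<bar>f (x, y) - f (x, y')\<bar> \<le> oscillation U C f k x"
proof -
  have "bdd_above ((\<lambda>q. \<bar>f (x, fst q) - f (x, snd q)\<bar>) ` same_cell U C k)"
  proof (rule bdd_aboveI2)
    fix q assume "q \<in> same_cell U C k"
    then have "fst q \<in> C" "snd q \<in> C" by (auto simp: same_cell_def)
    then show "\<bar>f (x, fst q) - f (x, snd q)\<bar> \<le> 2 * B" using B[of "fst q"] B[of "snd q"] by linarith
  qed
  then show ?thesis unfolding oscillation_def using cSUP_upper[OF assms(2)] by fastforce
qed

lemma oscillation_least:
  assumes "C \<noteq> {}" and "\<And>y y'. (y, y') \<in> same_cell U C k \<Longrightarrow> \<bar>f (x, y) - f (x, y')\<bar> \<le> E"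
  shows "oscillation U C f k x \<le> E"
  unfolding oscillation_def
proof (rule cSUP_least)
  show "same_cell U C k \<noteq> {}" using assms(1) by (auto simp: same_cell_def)
  show "\<And>q. q \<in> same_cell U C k \<Longrightarrow> \<bar>f (x, fst q) - f (x, snd q)\<bar> \<le> E" using assms(2) by auto
qed

lemma oscillation_bounds:
  assumes C: "C \<noteq> {}" and B: "\<And>y. y \<in> C \<Longrightarrow> \<bar>f (x, y)\<bar> \<le> B"
  shows "0 \<le> oscillation U C f k x" "oscillation U C f k x \<le> 2 * B"
proof -
  obtain y where y: "y \<in> C" using C by blast
  have "\<bar>f (x, y) - f (x, y)\<bar> \<le> oscillation U C f k x"
    using y B by (intro oscillation_upper) (auto simp: same_cell_def)
  then show "0 \<le> oscillation U C f k x" by simp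
  show "oscillation U C f k x \<le> 2 * B"
  proof (rule oscillation_least[OF C])
    fix y y' assume "(y, y') \<in> same_cell U C k"
    then have "y \<in> C" "y' \<in> C" by (auto simp: same_cell_def)
    then show "\<bar>f (x, y) - f (x, y')\<bar> \<le> 2 * B" using B[of y] B[of y'] by linarith
  qed
qed

lemma continuous_map_section_right:
  assumes "continuous_map (prod_topology X Y) Z f" "y \<in> topspace Y"
  shows "continuous_map X Z (\<lambda>x. f (x, y))"
  using continuous_map_compose[OF _ assms(1), of X "\<lambda>x. (x, y)"] assms(2)
  by (simp add: comp_def continuous_map_pairedI)

lemma continuous_map_section_left:
  assumes "continuous_map (prod_topology X Y) Z f" "x \<in> topspace X"
  shows "continuous_map Y Z (\<lambda>y. f (x, y))"
  using continuous_map_compose[OF _ assms(1), of Y "\<lambda>y. (x, y)"] assms(2)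
  by (simp add: comp_def continuous_map_pairedI)

text \<open>This is the tube lemma, applied to \<open>f z - f (x, snd z)\<close> near \<open>{x} \<times> C\<close>.\<close>
lemma uniform_on_compact_fibre:
  fixes f :: "'a \<times> 'b \<Rightarrow> real"
  assumes f: "continuous_map (prod_topology X Y) euclideanreal f" and C: "compactin Y C"
    and x: "x \<in> topspace X" and "e > 0"
  obtains V where "openin X V" "x \<in> V" "\<And>x' y. x' \<in> V \<Longrightarrow> y \<in> C \<Longrightarrow> \<bar>f (x', y) - f (x, y)\<bar> < e"
proof -
  let ?g = "\<lambda>z. f z - f (x, snd z)"
  have "continuous_map (prod_topology X Y) euclideanreal (\<lambda>z. f (x, snd z))"
    using continuous_map_compose[OF continuous_map_snd continuous_map_section_left[OF f x]]
    by (simp add: comp_def)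
  then have "continuous_map (prod_topology X Y) euclideanreal ?g"
    using f by (intro continuous_map_diff)
  then have W: "openin (prod_topology X Y) {z \<in> topspace (prod_topology X Y). ?g z \<in> {-e<..<e}}"
    by (rule openin_continuous_map_preimage) auto
  have "{x} \<times> C \<subseteq> {z \<in> topspace (prod_topology X Y). ?g z \<in> {-e<..<e}}"
    using x \<open>e > 0\<close> compactin_subset_topspace[OF C] by auto
  from tube_lemma_right[OF W C x this] obtain V V' where
    V: "openin X V" "x \<in> V" "C \<subseteq> V'" "V \<times> V' \<subseteq> {z \<in> topspace (prod_topology X Y). ?g z \<in> {-e<..<e}}"
    by auto
  show thesis
  proof (rule that[OF V(1,2)])
    fix x' y assume "x' \<in> V" "y \<in> C"
    then have "(x', y) \<in> V \<times> V'" using V by auto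
    then show "\<bar>f (x', y) - f (x, y)\<bar> < e" using V(4) by auto
  qed
qed

lemma continuous_map_realI:
  fixes g :: "'a \<Rightarrow> real"
  assumes "\<And>x e. x \<in> topspace X \<Longrightarrow> e > 0 \<Longrightarrow> \<exists>V. openin X V \<and> x \<in> V \<and> (\<forall>x'\<in>V. \<bar>g x' - g x\<bar> < e)"
  shows "continuous_map X euclideanreal g"
proof -
  have "\<exists>V. openin X V \<and> x \<in> V \<and> (\<forall>y\<in>V. g y \<in> Met_TC.mball (g x) \<epsilon>)" if "x \<in> topspace X" "\<epsilon> > 0" for x \<epsilon>
    using assms[OF that] by (auto simp: dist_real_def abs_minus_commute)
  then show ?thesis
    using Met_TC.continuous_map_to_metric[of X g] by simp
qed

lemma continuous_map_oscillation:
  assumes f: "f \<in> bounded_continuous (prod_topology X Y)" and C: "compactin Y C" "C \<noteq> {}"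
  shows "continuous_map X euclideanreal (oscillation U C f k)"
proof (rule continuous_map_realI)
  fix x and e :: real assume x: "x \<in> topspace X" and e: "e > 0"
  have fc: "continuous_map (prod_topology X Y) euclideanreal f" using f by (simp add: bounded_continuous_def)
  obtain B where "\<And>z. z \<in> topspace (prod_topology X Y) \<Longrightarrow> \<bar>f z\<bar> \<le> B"
    using bounded_continuous_bound[OF f] by blast
  then have B: "\<bar>f (x, y)\<bar> \<le> B" if "x \<in> topspace X" "y \<in> C" for x y
    using that compactin_subset_topspace[OF C(1)] by auto
  have "e / 4 > 0" using e by simp
  then obtain V where V: "openin X V" "x \<in> V" "\<And>x' y. x' \<in> V \<Longrightarrow> y \<in> C \<Longrightarrow> \<bar>f (x', y) - f (x, y)\<bar> < e / 4"
    using uniform_on_compact_fibre[OF fc C(1) x] by metis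
  have Vs: "V \<subseteq> topspace X" using V(1) by (rule openin_subset)
  have le: "oscillation U C f k a \<le> oscillation U C f k b + e / 2"
    if "a \<in> topspace X" "b \<in> topspace X" and c: "\<And>y. y \<in> C \<Longrightarrow> \<bar>f (a, y) - f (b, y)\<bar> < e / 4" for a b
  proof (rule oscillation_least[OF C(2)])
    fix y y' assume yy: "(y, y') \<in> same_cell U C k"
    then have "y \<in> C" "y' \<in> C" by (auto simp: same_cell_def)
    moreover have "\<bar>f (b, y) - f (b, y')\<bar> \<le> oscillation U C f k b"
      using B that yy by (intro oscillation_upper)
    ultimately show "\<bar>f (a, y) - f (a, y')\<bar> \<le> oscillation U C f k b + e / 2"
      using c[of y] c[of y'] by linarith
  qed
  have "\<bar>oscillation U C f k x' - oscillation U C f k x\<bar> < e" if "x' \<in> V" for x'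
  proof -
    have "x' \<in> topspace X" using that Vs by blast
    then have "oscillation U C f k x' \<le> oscillation U C f k x + e / 2"
      "oscillation U C f k x \<le> oscillation U C f k x' + e / 2"
      using V(3)[OF that] x by (auto intro!: le simp: abs_minus_commute)
    then show ?thesis using e by linarith
  qed
  with V show "\<exists>V. openin X V \<and> x \<in> V \<and> (\<forall>x'\<in>V. \<bar>oscillation U C f k x' - oscillation U C f k x\<bar> < e)"
    by blast
qed

text \<open>Finitely many basic sets \<open>U n\<close> on which \<open>f(x, \<cdot>)\<close> varies by less than \<open>\<epsilon>/2\<close> cover \<open>C\<close>. As soon as \<open>k\<close> exceeds their indices, every cell of depth
\<open>k\<close> lies in one of them.\<close>
lemma oscillation_tendsto_0:
  assumes f: "f \<in> bounded_continuous (prod_topology X Y)" and C: "compactin Y C" "C \<noteq> {}"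
    and U: "\<And>n. openin (subtopology Y C) (U n)"
      "\<And>W y. openin (subtopology Y C) W \<Longrightarrow> y \<in> W \<Longrightarrow> \<exists>n. y \<in> U n \<and> U n \<subseteq> W"
    and x: "x \<in> topspace X"
  shows "(\<lambda>k. oscillation U C f k x) \<longlonglongrightarrow> 0"
proof (rule tendstoI)
  fix e :: real assume e: "e > 0"
  have fc: "continuous_map (prod_topology X Y) euclideanreal f" using f by (simp add: bounded_continuous_def)
  have CY: "C \<subseteq> topspace Y" by (rule compactin_subset_topspace[OF C(1)])
  obtain B where "\<And>z. z \<in> topspace (prod_topology X Y) \<Longrightarrow> \<bar>f z\<bar> \<le> B"
    using bounded_continuous_bound[OF f] by blast
  then have B: "\<bar>f (x, y)\<bar> \<le> B" if "y \<in> C" for y using that CY x by auto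
  have g: "continuous_map (subtopology Y C) euclideanreal (\<lambda>y. f (x, y))"
    using continuous_map_section_left[OF fc x] by (rule continuous_map_from_subtopology)
  have "\<exists>n. y \<in> U n \<and> (\<forall>y'\<in>U n. \<bar>f (x, y') - f (x, y)\<bar> < e / 4)" if y: "y \<in> C" for y
  proof -
    let ?W = "{y' \<in> topspace (subtopology Y C). f (x, y') \<in> ball (f (x, y)) (e / 4)}"
    have "openin (subtopology Y C) ?W"
      by (rule openin_continuous_map_preimage[OF g]) auto
    moreover have "y \<in> ?W" using y CY e by auto
    ultimately obtain n where "y \<in> U n" "U n \<subseteq> ?W" using U(2) by blast
    then show ?thesis by (auto simp: dist_real_def abs_minus_commute)
  qed
  then obtain N where N: "\<And>y. y \<in> C \<Longrightarrow> y \<in> U (N y)"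
    "\<And>y y'. y \<in> C \<Longrightarrow> y' \<in> U (N y) \<Longrightarrow> \<bar>f (x, y') - f (x, y)\<bar> < e / 4" by metis
  have "compact_space (subtopology Y C)" using C(1) by (rule compact_space_subtopology)
  then have "\<exists>\<F>. finite \<F> \<and> \<F> \<subseteq> (\<lambda>y. U (N y)) ` C \<and> topspace (subtopology Y C) \<subseteq> \<Union>\<F>"
    using N(1) U(1) CY unfolding compact_space_alt by (smt (verit) UN_iff image_iff subsetI topspace_subtopology_subset)
  then obtain D where D: "finite D" "D \<subseteq> C" "C \<subseteq> (\<Union>y\<in>D. U (N y))"
    using CY by (smt (verit, best) finite_subset_image topspace_subtopology_subset)
  define K where "K = Suc (Max (N ` D))"
  have "oscillation U C f k x \<le> e / 2" if k: "k \<ge> K" for k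
  proof (rule oscillation_least[OF C(2)])
    fix y y' assume yy: "(y, y') \<in> same_cell U C k"
    then obtain a where a: "a \<in> D" "y \<in> U (N a)" using D(3) by (auto simp: same_cell_def)
    have "N a \<le> Max (N ` D)" using a D(1) by auto
    then have "N a < k" using k by (simp add: K_def)
    then have "y' \<in> U (N a)" using yy a by (auto simp: same_cell_def)
    then show "\<bar>f (x, y) - f (x, y')\<bar> \<le> e / 2"
      using N(2)[OF subsetD[OF D(2) a(1)] a(2)] N(2)[OF subsetD[OF D(2) a(1)], of y'] by linarith
  qed
  moreover have "0 \<le> oscillation U C f k x" for k
    using B by (rule oscillation_bounds[OF C(2)])
  ultimately have "\<forall>k\<ge>K. dist (oscillation U C f k x) 0 < e"
    using e by (fastforce simp: dist_real_def)
  then show "eventually (\<lambda>k. dist (oscillation U C f k x) 0 < e) sequentially"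
    unfolding eventually_sequentially by blast
qed

section \<open>Conditional probabilities along the tree\<close>

lemma emeasure_conditional_measure:
  assumes "A \<in> sets M" "E \<in> sets M"
  shows "emeasure (conditional_measure M A) E = ennreal (1 / measure M A) * emeasure M (A \<inter> E)"
proof -
  have "emeasure (conditional_measure M A) E = (\<integral>\<^sup>+x. ennreal (indicator A x / measure M A) * indicator E x \<partial>M)"
    unfolding conditional_measure_def using assms by (intro emeasure_density) auto
  also have "\<dots> = (\<integral>\<^sup>+x. ennreal (1 / measure M A) * indicator (A \<inter> E) x \<partial>M)"
    by (intro nn_integral_cong) (auto simp: indicator_def)
  also have "\<dots> = ennreal (1 / measure M A) * emeasure M (A \<inter> E)"
    using assms by (intro nn_integral_cmult_indicator) auto
  finally show ?thesis .
qed

lemma fst_measurable_prod: "fst \<in> measurable (borel_of (prod_topology X Y)) (borel_of X)"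
  by (rule continuous_map_measurable[OF continuous_map_fst])

lemma snd_measurable_prod: "snd \<in> measurable (borel_of (prod_topology X Y)) (borel_of Y)"
  by (rule continuous_map_measurable[OF continuous_map_snd])

lemma Times_borel_of:
  assumes G: "G \<in> sets (borel_of X)" and B: "B \<in> sets (borel_of Y)"
  shows "G \<times> B \<in> sets (borel_of (prod_topology X Y))"
proof -
  have "fst -` G \<inter> space (borel_of (prod_topology X Y)) \<inter> (snd -` B \<inter> space (borel_of (prod_topology X Y)))
      \<in> sets (borel_of (prod_topology X Y))"
    using measurable_sets[OF fst_measurable_prod G] measurable_sets[OF snd_measurable_prod B] by blast
  also have "fst -` G \<inter> space (borel_of (prod_topology X Y)) \<inter> (snd -` B \<inter> space (borel_of (prod_topology X Y))) = G \<times> B"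
    using sets.sets_into_space[OF G] sets.sets_into_space[OF B] by auto
  finally show ?thesis .
qed

text \<open>The measure \<open>G \<mapsto> M (G \<times> B)\<close> on \<open>X\<close>, which is the projection of the part of \<open>M\<close> that lies over \<open>B\<close>.\<close>
definition slice :: "'a topology \<Rightarrow> ('a \<times> 'b) measure \<Rightarrow> 'b set \<Rightarrow> 'a measure" where
  "slice X M B = distr (density M (indicator (topspace X \<times> B))) (borel_of X) fst"

lemma sets_slice [simp]: "sets (slice X M B) = sets (borel_of X)"
  by (simp add: slice_def)

lemma emeasure_slice:
  assumes M: "sets M = sets (borel_of (prod_topology X Y))"
    and G: "G \<in> sets (borel_of X)" and B: "B \<in> sets (borel_of Y)"
  shows "emeasure (slice X M B) G = emeasure M (G \<times> B)"
proof -
  have sp: "space M = topspace X \<times> topspace Y" using sets_eq_imp_space_eq[OF M] by simp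
  have XB: "topspace X \<times> B \<in> sets M" using Times_borel_of[OF _ B, of "topspace X" X] M
    by (metis sets.top space_borel_of)
  have GY: "fst -` G \<inter> space M \<in> sets M"
    using measurable_sets[OF fst_measurable_prod G, of Y] M sets_eq_imp_space_eq[OF M] by simp
  have f: "fst \<in> measurable (density M (indicator (topspace X \<times> B))) (borel_of X)"
    using fst_measurable_prod[of X Y] by (simp add: measurable_cong_sets[OF M refl])
  have "emeasure (slice X M B) G = emeasure (density M (indicator (topspace X \<times> B))) (fst -` G \<inter> space M)"
    unfolding slice_def using f G by (simp add: emeasure_distr)
  also have "\<dots> = (\<integral>\<^sup>+z. indicator (topspace X \<times> B) z * indicator (fst -` G \<inter> space M) z \<partial>M)"
    using XB GY by (intro emeasure_density) auto
  also have "\<dots> = (\<integral>\<^sup>+z. indicator (G \<times> B) z \<partial>M)"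
  proof (rule nn_integral_cong)
    fix z assume "z \<in> space M"
    then show "indicator (topspace X \<times> B) z * indicator (fst -` G \<inter> space M) z = (indicator (G \<times> B) z :: ennreal)"
      unfolding sp by (cases z) (auto simp: indicator_def)
  qed
  also have "\<dots> = emeasure M (G \<times> B)"
    using Times_borel_of[OF G B] M by simp
  finally show ?thesis .
qed

lemma cell_borel:
  assumes "\<And>n. C \<inter> U n \<in> sets (borel_of Y)" "C \<in> sets (borel_of Y)"
  shows "cell U C s \<in> sets (borel_of Y)"
proof (induction s)
  case (Cons d s)
  have "cell U C s \<inter> U (length s) = cell U C s \<inter> (C \<inter> U (length s))"
    "cell U C s - U (length s) = cell U C s - (C \<inter> U (length s))"
    using cell_subset[of U C s] by auto
  then show ?case using Cons assms(1)[of "length s"] by (cases d) (simp_all add: sets.Int sets.Diff)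
qed (use assms in simp)

lemma node_prob_measurable:
  assumes "\<And>s. p s \<in> borel_measurable M"
  shows "(\<lambda>x. node_prob (\<lambda>s. p s x) s) \<in> borel_measurable M"
proof (induction s)
  case (Cons d s)
  note [measurable] = Cons assms[of s]
  show ?case by (cases d) (simp_all)
qed simp

lemma continuous_map_node_prob:
  assumes "\<And>s. continuous_map X euclideanreal (P s)"
  shows "continuous_map X euclideanreal (\<lambda>x. node_prob (\<lambda>s. P s x) s)"
proof (induction s)
  case (Cons d s)
  then show ?case using assms[of s]
    by (cases d) (auto intro!: continuous_map_real_mult continuous_map_diff)
qed simp

text \<open>A disintegration of \<open>M\<close> over \<open>X\<close> in coordinates: the slice over a child is dominated by the slice over its
parent and has a density \<open>p s\<close> with respect to it, and densities multiply along the branches of the tree.\<close>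
lemma transition_probabilities:
  fixes M :: "('a \<times> 'b) measure"
  assumes M: "sets M = sets (borel_of (prod_topology X Y))" "finite_measure M"
    and cells: "\<And>s. cell U C s \<in> sets (borel_of Y)"
  obtains p where "\<And>s. p s \<in> borel_measurable (borel_of X)" "\<And>s x. 0 \<le> p s x \<and> p s x \<le> (1::real)"
    "\<And>s. slice X M (cell U C s) = density (slice X M C) (\<lambda>x. ennreal (node_prob (\<lambda>s. p s x) s))"
proof -
  interpret finite_measure M by (rule M)
  let ?\<nu> = "\<lambda>s. slice X M (cell U C s)"
  have em: "emeasure (?\<nu> s) G = emeasure M (G \<times> cell U C s)" if "G \<in> sets (borel_of X)" for s G
    using emeasure_slice[OF M(1) that cells] .
  have fin: "finite_measure (?\<nu> s)" for s
  proof
    have "space (?\<nu> s) \<in> sets (borel_of X)" by (metis sets.top sets_slice)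
    then show "emeasure (?\<nu> s) (space (?\<nu> s)) \<noteq> \<infinity>" by (simp add: em)
  qed
  have le: "emeasure (?\<nu> (True # s)) G \<le> emeasure (?\<nu> s) G" if "G \<in> sets (?\<nu> s)" for s G
  proof -
    have G: "G \<in> sets (borel_of X)" using that by simp
    have "G \<times> cell U C s \<in> sets M" using Times_borel_of[OF G cells] M(1) by simp
    then show ?thesis by (subst (1 2) em) (use G in \<open>auto intro!: emeasure_mono\<close>)
  qed
  have "\<exists>p. p \<in> borel_measurable (borel_of X) \<and> (\<forall>x. 0 \<le> p x \<and> p x \<le> (1::real)) \<and>
      ?\<nu> (True # s) = density (?\<nu> s) (\<lambda>x. ennreal (p x))" for s
  proof -
    obtain p where "p \<in> borel_measurable (?\<nu> s)" "\<And>x. 0 \<le> p x \<and> p x \<le> (1::real)"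
      "?\<nu> (True # s) = density (?\<nu> s) (\<lambda>x. ennreal (p x))"
      using density_fraction[OF fin[of s], of "?\<nu> (True # s)"] le by (metis sets_slice)
    moreover from this(1) have "p \<in> borel_measurable (borel_of X)"
      by (simp add: measurable_cong_sets[OF sets_slice refl])
    ultimately show ?thesis by blast
  qed
  then obtain p where pm: "\<And>s. p s \<in> borel_measurable (borel_of X)"
    and pb: "\<And>s x. 0 \<le> p s x \<and> p s x \<le> (1::real)"
    and p: "\<And>s. ?\<nu> (True # s) = density (?\<nu> s) (\<lambda>x. ennreal (p s x))" by metis
  have pm' [measurable]: "p s \<in> borel_measurable (slice X M C)" for s
    using pm by (simp add: measurable_cong_sets[OF sets_slice refl])
  let ?q = "\<lambda>s x. node_prob (\<lambda>s. p s x) s"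
  have qm [measurable]: "?q s \<in> borel_measurable (slice X M C)" for s
    by (rule node_prob_measurable) (rule pm')
  have qb: "0 \<le> ?q s x" "?q s x \<le> 1" for s x
    using node_prob_bounds[of "\<lambda>s. p s x" s] pb by auto
  have "?\<nu> s = density (slice X M C) (\<lambda>x. ennreal (?q s x))" for s
  proof (induction s)
    case Nil
    show ?case by (simp add: density_1)
  next
    case (Cons d s)
    have T: "?\<nu> (True # s) = density (slice X M C) (\<lambda>x. ennreal (?q (True # s) x))"
      unfolding p Cons by (subst density_density_eq) (auto simp: ennreal_mult pb qb)
    show ?case
    proof (cases d)
      case True
      then show ?thesis using T by simp
    next
      case False
      have "?\<nu> (False # s) = density (slice X M C) (\<lambda>x. ennreal (?q (False # s) x))"
      proof (rule measure_eqI)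
        fix G assume "G \<in> sets (?\<nu> (False # s))"
        then have G: "G \<in> sets (borel_of X)" by simp
        have "emeasure (?\<nu> (True # s)) G + emeasure (?\<nu> (False # s)) G = emeasure (?\<nu> s) G"
        proof -
          have S: "G \<times> cell U C r \<in> sets M" for r
            using Times_borel_of[OF G cells] by (simp only: M(1))
          have "(G \<times> cell U C (True # s)) \<inter> (G \<times> cell U C (False # s)) = {}"
            "(G \<times> cell U C (True # s)) \<union> (G \<times> cell U C (False # s)) = G \<times> cell U C s" by auto
          with plus_emeasure[OF S S this(1)] show ?thesis by (simp only: em[OF G])
        qed
        also have "\<dots> = emeasure (density (slice X M C) (\<lambda>x. ennreal (?q (True # s) x) + ennreal (?q (False # s) x))) G"
        proof -
          have "ennreal (?q (True # s) x) + ennreal (?q (False # s) x) = ennreal (?q s x)" for x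
            using ennreal_plus[OF qb(1)[of x "True # s"] qb(1)[of x "False # s"]] by (simp add: algebra_simps)
          then show ?thesis unfolding Cons by simp
        qed
        also have "\<dots> = emeasure (?\<nu> (True # s)) G + emeasure (density (slice X M C) (\<lambda>x. ennreal (?q (False # s) x))) G"
          unfolding T using G by (intro emeasure_density_add[symmetric]) (auto simp del: node_prob.simps)
        finally show "emeasure (?\<nu> (False # s)) G = emeasure (density (slice X M C) (\<lambda>x. ennreal (?q (False # s) x))) G"
          using finite_measure.emeasure_finite[OF fin] by (simp add: ennreal_add_left_cancel del: cell.simps node_prob.simps)
      qed simp
      then show ?thesis using False by simp
    qed
  qed
  with pm pb show thesis by (rule that)
qed

text \<open>After conditioning on \<open>K \<times> C\<close>, a density matters only on \<open>K\<close>. This allows the measurable transition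
probabilities to be exchanged for continuous ones.\<close>
lemma slice_conditional_measure:
  fixes M :: "('a \<times> 'b) measure"
  assumes M: "sets M = sets (borel_of (prod_topology X Y))" "finite_measure M"
    and C: "C \<in> sets (borel_of Y)" and B: "B \<in> sets (borel_of Y)" "B \<subseteq> C" and K: "K \<in> sets (borel_of X)"
    and q: "slice X M B = density (slice X M C) (\<lambda>x. ennreal (q x))" "q \<in> borel_measurable (borel_of X)"
    and Q: "\<And>x. x \<in> K \<Longrightarrow> Q x = q x" "Q \<in> borel_measurable (borel_of X)"
  shows "slice X (conditional_measure M (K \<times> C)) B =
    density (distr (conditional_measure M (K \<times> C)) (borel_of X) fst) (\<lambda>x. ennreal (Q x))"
proof -
  let ?A = "K \<times> C" and ?M1 = "conditional_measure M (K \<times> C)"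
  define a where "a = ennreal (1 / measure M ?A)"
  have A: "?A \<in> sets M" using Times_borel_of[OF K C] M(1) by simp
  have s1: "sets ?M1 = sets (borel_of (prod_topology X Y))" by (simp add: conditional_measure_def M(1))
  have sp1: "space ?M1 = topspace X \<times> topspace Y" using sets_eq_imp_space_eq[OF s1] by simp
  have fm: "fst \<in> measurable ?M1 (borel_of X)"
    using fst_measurable_prod[of X Y] by (simp add: measurable_cong_sets[OF s1 refl])
  have em1: "emeasure ?M1 (G \<times> D) = a * emeasure (slice X M (D \<inter> C)) (G \<inter> K)"
    if "G \<in> sets (borel_of X)" "D \<in> sets (borel_of Y)" for G D
  proof -
    have "G \<times> D \<in> sets M" using Times_borel_of[OF that] M(1) by simp
    then have "emeasure ?M1 (G \<times> D) = a * emeasure M (?A \<inter> G \<times> D)"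
      using emeasure_conditional_measure[OF A] by (simp add: a_def)
    also have "?A \<inter> G \<times> D = (G \<inter> K) \<times> (D \<inter> C)" by auto
    also have "emeasure M \<dots> = emeasure (slice X M (D \<inter> C)) (G \<inter> K)"
      using that K C by (intro emeasure_slice[OF M(1), symmetric]) auto
    finally show ?thesis .
  qed
  have Km [measurable]: "K \<in> sets (slice X M C)" using K by simp
  have m1: "distr ?M1 (borel_of X) fst = density (slice X M C) (\<lambda>x. a * indicator K x)"
  proof (rule measure_eqI)
    fix G assume "G \<in> sets (distr ?M1 (borel_of X) fst)"
    then have G: "G \<in> sets (borel_of X)" by simp
    have top: "topspace Y \<in> sets (borel_of Y)" by (metis sets.top space_borel_of)
    have "emeasure (distr ?M1 (borel_of X) fst) G = emeasure ?M1 (G \<times> topspace Y)"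
    proof -
      have "fst -` G \<inter> space ?M1 = G \<times> topspace Y"
        using sets.sets_into_space[OF G] by (auto simp: sp1)
      then show ?thesis using emeasure_distr[OF fm G] by simp
    qed
    also have "\<dots> = a * emeasure (slice X M C) (G \<inter> K)"
      using em1[OF G top] sets.sets_into_space[OF C] by (simp add: Int_absorb1)
    also have "\<dots> = (\<integral>\<^sup>+x. a * indicator (G \<inter> K) x \<partial>slice X M C)"
      using G K by (subst nn_integral_cmult_indicator) auto
    also have "\<dots> = (\<integral>\<^sup>+x. a * indicator K x * indicator G x \<partial>slice X M C)"
      by (intro nn_integral_cong) (auto simp: indicator_def)
    also have "\<dots> = emeasure (density (slice X M C) (\<lambda>x. a * indicator K x)) G"
      using G by (intro emeasure_density[symmetric]) simp_all
    finally show "emeasure (distr ?M1 (borel_of X) fst) G = emeasure (density (slice X M C) (\<lambda>x. a * indicator K x)) G" .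
  qed simp
  have meas [measurable]: "q \<in> borel_measurable (slice X M C)" "Q \<in> borel_measurable (slice X M C)"
    using q(2) Q(2) by (simp_all add: measurable_cong_sets[OF sets_slice refl])
  show ?thesis
  proof (rule measure_eqI)
    fix G assume "G \<in> sets (slice X ?M1 B)"
    then have G: "G \<in> sets (borel_of X)" by simp
    then have Gm [measurable]: "G \<in> sets (slice X M C)" by simp
    have "emeasure (slice X ?M1 B) G = a * emeasure (slice X M B) (G \<inter> K)"
      using emeasure_slice[OF s1 G B(1)] em1[OF G B(1)] B(2) by (simp add: Int_absorb2)
    also have "\<dots> = a * (\<integral>\<^sup>+x. ennreal (q x) * indicator (G \<inter> K) x \<partial>slice X M C)"
      unfolding q(1) using G K by (subst emeasure_density) auto
    also have "\<dots> = (\<integral>\<^sup>+x. a * (ennreal (q x) * indicator (G \<inter> K) x) \<partial>slice X M C)"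
      by (rule nn_integral_cmult[symmetric]) measurable
    also have "\<dots> = (\<integral>\<^sup>+x. a * indicator K x * ennreal (Q x) * indicator G x \<partial>slice X M C)"
      by (intro nn_integral_cong) (auto simp: indicator_def Q(1))
    also have "\<dots> = emeasure (density (distr ?M1 (borel_of X) fst) (\<lambda>x. ennreal (Q x))) G"
      unfolding m1 by (subst density_density_eq) (measurable, rule emeasure_density[symmetric], measurable)
    finally show "emeasure (slice X ?M1 B) G = emeasure (density (distr ?M1 (borel_of X) fst) (\<lambda>x. ennreal (Q x))) G" .
  qed simp
qed

section \<open>Uniformly distributed sequences in the product\<close>

lemma integral_slice:
  fixes g :: "'a \<Rightarrow> real"
  assumes M: "sets M = sets (borel_of (prod_topology X Y))"
    and B: "B \<in> sets (borel_of Y)" and g: "g \<in> borel_measurable (borel_of X)"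
  shows "integral\<^sup>L (slice X M B) g = integral\<^sup>L M (\<lambda>z. indicator (topspace X \<times> B) z * g (fst z))"
proof -
  have XB: "topspace X \<times> B \<in> sets M" using Times_borel_of[OF _ B, of "topspace X" X] M
    by (metis sets.top space_borel_of)
  have f: "fst \<in> measurable M (borel_of X)"
    using fst_measurable_prod[of X Y] by (simp add: measurable_cong_sets[OF M refl])
  have gf: "(\<lambda>z. g (fst z)) \<in> borel_measurable M"
    using measurable_compose[OF f g] .
  have d: "density M (indicator (topspace X \<times> B)) = density M (\<lambda>z. ennreal (indicator (topspace X \<times> B) z))"
    by (simp add: ennreal_indicator)
  have "integral\<^sup>L (slice X M B) g = integral\<^sup>L (density M (\<lambda>z. ennreal (indicator (topspace X \<times> B) z))) (\<lambda>z. g (fst z))"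
    unfolding slice_def d using f g by (intro integral_distr) auto
  also have "\<dots> = integral\<^sup>L M (\<lambda>z. indicator (topspace X \<times> B) z *\<^sub>R g (fst z))"
    using XB gf by (intro integral_density) auto
  finally show ?thesis by simp
qed

text \<open>With continuous transition probabilities, the function \<open>F x\<close> below, a discretization at depth \<open>k\<close> of the integral of \<open>f(x, \<cdot>)\<close> against the
kernel, is continuous, and so is the oscillation. The averages of both along the sequence \<open>x\<close> therefore converge, and
the sum of both bounds the column averages required by \<open>diagonal_average_le\<close>.\<close>
lemma ud_sequence_continuous_transitions:
  fixes X :: "'a topology" and Y :: "'b topology" and M :: "('a \<times> 'b) measure"
  defines "m \<equiv> distr M (borel_of X) fst"
  assumes H: "Hausdorff_space X" "Hausdorff_space Y"
    and C: "compactin Y C" "C \<noteq> {}"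
    and U: "\<And>n. openin (subtopology Y C) (U n)"
      "\<And>W y. openin (subtopology Y C) W \<Longrightarrow> y \<in> W \<Longrightarrow> \<exists>n. y \<in> U n \<and> U n \<subseteq> W"
    and cells: "\<And>s. cell U C s \<in> sets (borel_of Y)"
    and M: "sets M = sets (borel_of (prod_topology X Y))" "prob_space M"
    and supp: "AE z in M. snd z \<in> C"
    and P: "\<And>s. continuous_map X euclideanreal (P s)" "\<And>s x. x \<in> topspace X \<Longrightarrow> 0 \<le> P s x \<and> P s x \<le> 1"
    and slices: "\<And>s. slice X M (cell U C s) = density m (\<lambda>x. ennreal (node_prob (\<lambda>s. P s x) s))"
    and x: "ud_sequence t X m x"
  shows "ud_sequence t (prod_topology X Y) M
    (\<lambda>N. case prod_decode N of (i, j) \<Rightarrow> (x i, cell_point U C (route (\<lambda>s. P s (x i)) j j)))"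
proof -
  interpret prob_space M by (rule M)
  let ?Z = "prod_topology X Y"
  let ?z = "\<lambda>i j. (x i, cell_point U C (route (\<lambda>s. P s (x i)) j j))"
  have CY: "C \<subseteq> topspace Y" by (rule compactin_subset_topspace[OF C(1)])
  have xX: "x i \<in> topspace X" for i
    using x by (auto simp: ud_sequence_def uniformly_distributed_def)
  have xlim: "(\<lambda>n. (\<Sum>i<n. g (x i)) / real n) \<longlonglongrightarrow> integral\<^sup>L m g" if "g \<in> bounded_continuous X" for g
    using x that by (auto simp: ud_sequence_def uniformly_distributed_def)
  have sp: "space M = topspace X \<times> topspace Y" using sets_eq_imp_space_eq[OF M(1)] by simp
  have ptC: "cell_point U C s \<in> C" for s using cell_point_in[OF C(2)] .
  have zin: "?z i j \<in> topspace ?Z" for i j using xX ptC CY by auto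
  have fm: "fst \<in> measurable M (borel_of X)"
    using fst_measurable_prod[of X Y] by (simp add: measurable_cong_sets[OF M(1) refl])
  have m: "prob_space m" unfolding m_def using fm by (rule prob_space_distr)
  have sm: "sets m = sets (borel_of X)" "space m = topspace X" by (simp_all add: m_def)
  interpret m: prob_space m by (rule m)
  let ?Q = "\<lambda>s x. node_prob (\<lambda>s. P s x) s"
  have Qc: "continuous_map X euclideanreal (?Q s)" for s
    by (rule continuous_map_node_prob) (rule P(1))
  have Qb: "0 \<le> ?Q s x" "?Q s x \<le> 1" if "x \<in> topspace X" for s x
    using node_prob_bounds[of "\<lambda>s. P s x" s] P(2)[OF that] by auto
  have cm: "g \<in> borel_measurable m" if "continuous_map X euclideanreal g" for g
    using continuous_map_borel_measurable[OF that] by (simp add: measurable_cong_sets[OF sm(1) refl])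
  have cmM: "g \<in> borel_measurable M" if "continuous_map ?Z euclideanreal g" for g
    using continuous_map_borel_measurable[OF that] by (simp add: measurable_cong_sets[OF M(1) refl])
  have upper: "eventually (\<lambda>n. (\<Sum>N<n. f (case prod_decode N of (i, j) \<Rightarrow> ?z i j)) / real n \<le> integral\<^sup>L M f + \<epsilon>) sequentially"
    if f: "f \<in> bounded_continuous ?Z" and e: "\<epsilon> > 0" for f \<epsilon>
  proof -
    have fc: "continuous_map ?Z euclideanreal f" using f by (simp add: bounded_continuous_def)
    obtain B where B0: "B > 0" and B: "\<And>z. z \<in> topspace ?Z \<Longrightarrow> \<bar>f z\<bar> \<le> B"
      using bounded_continuous_bound[OF f] by blast
    have Bxy: "\<bar>f (x, y)\<bar> \<le> B" if "x \<in> topspace X" "y \<in> C" for x y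
      using B that CY by auto
    let ?osc = "oscillation U C f"
    have oc: "continuous_map X euclideanreal (?osc k)" for k
      using f C by (rule continuous_map_oscillation)
    have ob: "0 \<le> ?osc k x" "?osc k x \<le> 2 * B" if "x \<in> topspace X" for k x
      using oscillation_bounds[OF C(2), of f x B U k] Bxy[OF that] by auto
    \<comment> \<open>The error \<open>\<epsilon> / 4\<close> is spent twice: in \<open>u\<close>, and in comparing the integrals of \<open>F\<close> and \<open>f\<close>.\<close>
    have "(\<lambda>k. integral\<^sup>L m (?osc k)) \<longlonglongrightarrow> integral\<^sup>L m (\<lambda>x. 0)"
    proof (rule integral_dominated_convergence[where w="\<lambda>x. 2 * B"])
      show "AE x in m. (\<lambda>k. ?osc k x) \<longlonglongrightarrow> 0"
        by (intro AE_I2 oscillation_tendsto_0[OF f C U]) (simp_all add: sm)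
      show "\<And>k. AE x in m. norm (?osc k x) \<le> 2 * B"
        using ob by (intro AE_I2) (auto simp: sm)
    qed (auto intro: cm oc)
    then have "(\<lambda>k. integral\<^sup>L m (?osc k)) \<longlonglongrightarrow> 0" by simp
    then have "eventually (\<lambda>k. integral\<^sup>L m (?osc k) < \<epsilon> / 4) sequentially"
      using e by (intro order_tendstoD(2)) auto
    then obtain k where k: "integral\<^sup>L m (?osc k) < \<epsilon> / 4" by (auto simp: eventually_sequentially)
    let ?S = "{s :: bool list. length s = k}"
    let ?pt = "cell_point U C"
    have fptc: "continuous_map X euclideanreal (\<lambda>x. f (x, ?pt s))" for s
      using continuous_map_section_right[OF fc, of "?pt s"] ptC CY by auto
    define F where "F x = (\<Sum>s\<in>?S. ?Q s x * f (x, ?pt s))" for x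
    have Fc: "continuous_map X euclideanreal F"
      unfolding F_def using finite_bool_lists Qc fptc
      by (intro continuous_map_sum continuous_map_real_mult) auto
    define u where "u = (\<lambda>x. F x + ?osc k x)"
    have uc: "continuous_map X euclideanreal u"
      unfolding u_def using Fc oc by (intro continuous_map_add)
    have "\<bar>u x\<bar> \<le> real (card ?S) * B + 2 * B" if xx: "x \<in> topspace X" for x
    proof -
      have "\<bar>F x\<bar> \<le> (\<Sum>s\<in>?S. \<bar>?Q s x * f (x, ?pt s)\<bar>)" unfolding F_def by (rule sum_abs)
      also have "\<dots> \<le> (\<Sum>s\<in>?S. 1 * B)"
        unfolding abs_mult using Qb[OF xx] Bxy[OF xx ptC] by (intro sum_mono mult_mono) auto
      finally show ?thesis using ob[OF xx, of k] by (simp add: u_def)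
    qed
    with uc have "u \<in> bounded_continuous X" by (rule bounded_continuousI)
    then have ulim: "(\<lambda>n. (\<Sum>i<n. u (x i)) / real n) \<longlonglongrightarrow> integral\<^sup>L m u" by (rule xlim)
    have bint: "integrable m g" if "continuous_map X euclideanreal g" "\<And>x. x \<in> topspace X \<Longrightarrow> \<bar>g x\<bar> \<le> A" for g and A :: real
      using that cm by (intro m.integrable_const_bound[of _ A]) (auto simp: sm intro!: AE_I2)
    have oint: "integrable m (?osc k)" using oc ob by (intro bint[of _ "2 * B"]) auto
    have Qfint: "integrable m (\<lambda>x. ?Q s x * f (x, ?pt s))" for s
    proof (rule bint)
      show "continuous_map X euclideanreal (\<lambda>x. ?Q s x * f (x, ?pt s))"
        using Qc fptc by (intro continuous_map_real_mult)
      show "\<bar>?Q s x * f (x, ?pt s)\<bar> \<le> 1 * B" if "x \<in> topspace X" for x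
        unfolding abs_mult using Qb[OF that] Bxy[OF that ptC] by (intro mult_mono) auto
    qed
    have Fint: "integrable m F" unfolding F_def using Qfint by (intro Bochner_Integration.integrable_sum) auto
    let ?I = "\<lambda>s z. indicator (topspace X \<times> cell U C s) z :: real"
    have slice_int: "integral\<^sup>L m (\<lambda>x. ?Q s x * g x) = integral\<^sup>L M (\<lambda>z. ?I s z * g (fst z))"
      if g: "continuous_map X euclideanreal g" for s g
    proof -
      have "integral\<^sup>L M (\<lambda>z. ?I s z * g (fst z)) = integral\<^sup>L (slice X M (cell U C s)) g"
        using integral_slice[OF M(1) cells] continuous_map_borel_measurable[OF g] by metis
      also have "\<dots> = integral\<^sup>L m (\<lambda>x. ?Q s x *\<^sub>R g x)"
        unfolding slices using Qb Qc g cm by (intro integral_density) (auto simp: sm intro!: AE_I2)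
      finally show ?thesis by simp
    qed
    have Im: "?I s \<in> borel_measurable M" for s
    proof -
      have "topspace X \<times> cell U C s \<in> sets M"
        using Times_borel_of[OF _ cells, of "topspace X" X] M(1) by (metis sets.top space_borel_of)
      then show ?thesis by simp
    qed
    have bintM: "integrable M g" if "g \<in> borel_measurable M" "\<And>z. z \<in> topspace ?Z \<Longrightarrow> \<bar>g z\<bar> \<le> A" for g and A :: real
      using that by (intro integrable_const_bound[of _ A]) (auto simp: sp intro!: AE_I2)
    have fstm: "(\<lambda>z. g (fst z)) \<in> borel_measurable M" if "continuous_map X euclideanreal g" for g
      using measurable_compose[OF fm continuous_map_borel_measurable[OF that]] .
    have IfintM: "integrable M (\<lambda>z. ?I s z * f (fst z, ?pt s))" for s
    proof (rule bintM)
      show "(\<lambda>z. ?I s z * f (fst z, ?pt s)) \<in> borel_measurable M"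
        using Im fstm[OF fptc] by (rule borel_measurable_times)
      show "\<bar>?I s z * f (fst z, ?pt s)\<bar> \<le> 1 * B" if "z \<in> topspace ?Z" for z
        unfolding abs_mult using that Bxy[OF _ ptC] by (intro mult_mono) (auto simp: indicator_def)
    qed
    have ointM: "integrable M (\<lambda>z. ?osc k (fst z))"
      using fstm[OF oc] ob by (intro bintM[of _ "2 * B"]) auto
    have fintM: "integrable M f" using cmM[OF fc] B by (intro bintM[of _ B]) auto
    \<comment> \<open>On \<open>X \<times> cell U C s\<close>, the function \<open>f\<close> differs from \<open>f(fst z, cell_point U C s)\<close> by at most the oscillation.\<close>
    have "integral\<^sup>L m F = (\<Sum>s\<in>?S. integral\<^sup>L M (\<lambda>z. ?I s z * f (fst z, ?pt s)))"
      unfolding F_def using Qfint slice_int[OF fptc] by (subst Bochner_Integration.integral_sum) auto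
    also have "\<dots> = integral\<^sup>L M (\<lambda>z. \<Sum>s\<in>?S. ?I s z * f (fst z, ?pt s))"
      using IfintM by (intro Bochner_Integration.integral_sum[symmetric]) auto
    also have "\<dots> \<le> integral\<^sup>L M (\<lambda>z. f z + ?osc k (fst z))"
    proof (rule integral_mono_AE)
      show "integrable M (\<lambda>z. \<Sum>s\<in>?S. ?I s z * f (fst z, ?pt s))"
        using IfintM by (intro Bochner_Integration.integrable_sum) auto
      show "integrable M (\<lambda>z. f z + ?osc k (fst z))" using fintM ointM by auto
      show "AE z in M. (\<Sum>s\<in>?S. ?I s z * f (fst z, ?pt s)) \<le> f z + ?osc k (fst z)"
        using supp AE_space
      proof eventually_elim
        case (elim z)
        then obtain a b where z: "z = (a, b)" "a \<in> topspace X" "b \<in> C" by (auto simp: sp)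
        have "(\<Sum>s\<in>?S. ?I s z * f (fst z, ?pt s)) \<le> (\<Sum>s\<in>?S. indicator (cell U C s) b * (f z + ?osc k a))"
        proof (rule sum_mono)
          fix s assume s: "s \<in> ?S"
          show "?I s z * f (fst z, ?pt s) \<le> indicator (cell U C s) b * (f z + ?osc k a)"
          proof (cases "b \<in> cell U C s")
            case True
            then have "?pt s \<in> cell U C s" using cell_point_in_cell[OF C(2)] by blast
            then have "(?pt s, b) \<in> same_cell U C k" using same_cellI[of "?pt s" U C s b] True s by simp
            then have "\<bar>f (a, ?pt s) - f (a, b)\<bar> \<le> ?osc k a"
              using Bxy[OF z(2)] by (intro oscillation_upper)
            then show ?thesis using True z by simp
          qed (use z in \<open>simp add: indicator_def\<close>)
        qed
        also have "\<dots> = f z + ?osc k a"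
          using sum_indicator_cell[OF z(3), of U k] by (simp add: sum_distrib_right[symmetric])
        finally show ?case using z by simp
      qed
    qed
    also have "\<dots> = integral\<^sup>L M f + integral\<^sup>L M (\<lambda>z. ?osc k (fst z))"
      using fintM ointM by simp
    also have "integral\<^sup>L M (\<lambda>z. ?osc k (fst z)) = integral\<^sup>L m (?osc k)"
      unfolding m_def using fm continuous_map_borel_measurable[OF oc] by (intro integral_distr[symmetric]) auto
    finally have "integral\<^sup>L m u \<le> integral\<^sup>L M f + \<epsilon> / 2"
      using k Fint oint by (simp add: u_def)
    moreover have "eventually (\<lambda>n. (\<Sum>N<n. case_prod (\<lambda>i j. f (?z i j)) (prod_decode N)) / real n \<le> integral\<^sup>L m u + \<epsilon> / 2) sequentially"
    proof (rule diagonal_average_le)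
      show "\<bar>f (?z i j)\<bar> \<le> B" for i j using B zin by blast
      show "(\<Sum>j<J. f (?z i j)) \<le> (real (card ?S) * real k * B + 2 * B * real k) + real J * u (x i)" for i J
        unfolding u_def F_def
      proof (rule route_sum_le[OF _ C(2)])
        show "0 \<le> P s (x i) \<and> P s (x i) \<le> 1" for s using P(2) xX by blast
        show "\<bar>f (x i, y)\<bar> \<le> B" if "y \<in> C" for y using Bxy xX that by blast
        show "\<bar>f (x i, y) - f (x i, y')\<bar> \<le> ?osc k (x i)" if "(y, y') \<in> same_cell U C k" for y y'
          using Bxy[OF xX] that by (rule oscillation_upper)
      qed
    qed (use ulim e in auto)
    ultimately show ?thesis
      by (auto elim!: eventually_mono simp: case_prod_unfold)
  qed
  have "(\<lambda>n. (\<Sum>N<n. f (case prod_decode N of (i, j) \<Rightarrow> ?z i j)) / real n) \<longlonglongrightarrow> integral\<^sup>L M f"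
    if f: "f \<in> bounded_continuous ?Z" for f
  proof (rule tendstoI)
    fix \<epsilon> :: real assume e: "\<epsilon> > 0"
    then have e2: "\<epsilon> / 2 > 0" by simp
    show "eventually (\<lambda>n. dist ((\<Sum>N<n. f (case prod_decode N of (i, j) \<Rightarrow> ?z i j)) / real n) (integral\<^sup>L M f) < \<epsilon>) sequentially"
      using upper[OF f e2] upper[OF bounded_continuous_uminus[OF f] e2]
    proof eventually_elim
      case (elim n)
      then show ?case using e by (simp add: dist_real_def sum_negf)
    qed
  qed
  moreover have "range (\<lambda>N. case prod_decode N of (i, j) \<Rightarrow> ?z i j) \<subseteq> topspace ?Z"
    using zin by (auto split: prod.splits)
  moreover have "tight_sequence ?Z (\<lambda>N. case prod_decode N of (i, j) \<Rightarrow> ?z i j)" if t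
    unfolding tight_sequence_def
  proof (intro allI impI)
    fix \<epsilon> :: real assume e: "\<epsilon> > 0"
    then have "\<epsilon> / 3 > 0" by simp
    moreover have "tight_sequence X x" using x that by (simp add: ud_sequence_def)
    ultimately obtain K where K: "compactin X K" "\<And>n. real (card {i. i < n \<and> x i \<notin> K}) \<le> \<epsilon> / 3 * real n"
      unfolding tight_sequence_def by meson
    have "real (card {N. N < n \<and> (case prod_decode N of (i, j) \<Rightarrow> ?z i j) \<notin> K \<times> C}) \<le> \<epsilon> * real n" for n
    proof -
      have "{N. N < n \<and> (case prod_decode N of (i, j) \<Rightarrow> ?z i j) \<notin> K \<times> C} = {N. N < n \<and> x (fst (prod_decode N)) \<notin> K}"
        using ptC by (auto simp: case_prod_unfold)
      then show ?thesis using diagonal_count_le[of "\<lambda>i. x i \<notin> K", OF K(2)] e by simp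
    qed
    moreover have "compactin ?Z (K \<times> C)" using K(1) C(1) by (simp add: compactin_Times)
    ultimately show "\<exists>K. compactin ?Z K \<and> (\<forall>n. real (card {N. N < n \<and> (case prod_decode N of (i, j) \<Rightarrow> ?z i j) \<notin> K}) \<le> \<epsilon> * real n)"
      by blast
  qed
  ultimately show ?thesis unfolding ud_sequence_def uniformly_distributed_def by blast
qed

text \<open>The set \<open>A = K \<times> C\<close>: regularity gives \<open>C\<close> with mass less than \<open>1/4\<close> outside \<open>X \<times> C\<close>, and
Lusin's theorem gives \<open>K\<close> with mass less than \<open>1/4\<close> outside \<open>K \<times> Y\<close>.\<close>
lemma ud_sequence_on_half_of_mass:
  fixes X :: "'a topology" and Y :: "'b topology" and M :: "('a \<times> 'b) measure"
  assumes cr: "completely_regular_space X" and H: "Hausdorff_space X" "Hausdorff_space Y"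
    and metr: "\<And>K. compactin Y K \<Longrightarrow> metrizable_space (subtopology Y K)"
    and ud: "\<And>m. radon_measure X m \<Longrightarrow> prob_space m \<Longrightarrow> \<exists>x. ud_sequence t X m x"
    and M: "radon_measure (prod_topology X Y) M" "prob_space M"
  shows "\<exists>A\<in>sets M. measure M A \<ge> 1/2 \<and> (\<exists>z. ud_sequence t (prod_topology X Y) (conditional_measure M A) z)"
proof -
  let ?Z = "prod_topology X Y"
  interpret prob_space M by (rule M(2))
  note D = radon_measureD[OF M(1)]
  have HZ: "Hausdorff_space ?Z" using H by (simp add: Hausdorff_space_prod_topology)
  have spM: "space M = topspace X \<times> topspace Y" by (simp add: D)
  have topY: "topspace Y \<in> sets (borel_of Y)" and topX: "topspace X \<in> sets (borel_of X)"
    by (metis sets.top space_borel_of)+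
  have "topspace ?Z \<in> sets (borel_of ?Z)" by (metis sets.top space_borel_of)
  then obtain Q where Q: "compactin ?Z Q" "Q \<subseteq> topspace ?Z" "measure M (topspace ?Z - Q) < 1/4"
    using radon_measure_inner[OF M(1), of "topspace ?Z" "1/4"] by auto
  define C where "C = snd ` Q"
  have C: "compactin Y C" unfolding C_def using Q(1) continuous_map_snd by (rule image_compactin)
  have CY: "C \<subseteq> topspace Y" by (rule compactin_subset_topspace[OF C])
  have Cb: "C \<in> sets (borel_of Y)" using compactin_borel_of[OF H(2) C] .
  have offC: "measure M (topspace X \<times> (topspace Y - C)) < 1/4"
  proof -
    have "topspace X \<times> (topspace Y - C) \<subseteq> topspace ?Z - Q" by (force simp: C_def)
    moreover have "topspace ?Z - Q \<in> sets M"
      using compactin_borel_of[OF HZ Q(1)] D by (metis sets.compl_sets)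
    ultimately show ?thesis using Q(3) finite_measure_mono by (meson order_le_less_trans)
  qed
  have "compact_space (subtopology Y C)" using C by (rule compact_space_subtopology)
  then have sc: "second_countable (subtopology Y C)"
    using metr[OF C] by (rule compact_metrizable_imp_second_countable)
  obtain U :: "nat \<Rightarrow> 'b set" where U: "\<And>n. openin (subtopology Y C) (U n)"
      "\<And>W y. openin (subtopology Y C) W \<Longrightarrow> y \<in> W \<Longrightarrow> \<exists>n. y \<in> U n \<and> U n \<subseteq> W"
    using second_countable_sequence[OF sc] by metis
  have "C \<inter> U n \<in> sets (borel_of Y)" for n
  proof -
    obtain T where "openin Y T" "U n = T \<inter> C" using U(1)[of n] by (auto simp: openin_subtopology)
    then have "C \<inter> U n = T \<inter> C" "T \<in> sets (borel_of Y)" by (auto intro: openin_borel_of)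
    then show ?thesis using Cb by auto
  qed
  then have cells: "cell U C s \<in> sets (borel_of Y)" for s using Cb by (rule cell_borel)
  obtain p where p: "\<And>s. p s \<in> borel_measurable (borel_of X)" "\<And>s x. 0 \<le> p s x \<and> p s x \<le> (1::real)"
    "\<And>s. slice X M (cell U C s) = density (slice X M C) (\<lambda>x. ennreal (node_prob (\<lambda>s. p s x) s))"
    using transition_probabilities[OF D(1,2) cells] by blast
  define m0 where "m0 = distr M (borel_of X) fst"
  have m0: "radon_measure X m0" unfolding m0_def
    using HZ H(1) M(1) continuous_map_fst by (rule radon_measure_distr)
  have pm0: "p s \<in> borel_measurable m0" for s
    using p(1)[of s] by (simp add: m0_def)
  obtain K where K: "compactin X K" "measure m0 (topspace X - K) < 1/4"
    "\<And>s. continuous_map (subtopology X K) euclideanreal (p s)"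
    using radon_lusin[where p = p and \<epsilon> = "1/4", OF H(1) m0 pm0] by auto
  have KX: "K \<subseteq> topspace X" by (rule compactin_subset_topspace[OF K(1)])
  have Kb: "K \<in> sets (borel_of X)" using compactin_borel_of[OF H(1) K(1)] .
  have "\<exists>g. continuous_map X euclideanreal g \<and> g ` topspace X \<subseteq> {0..1} \<and> (\<forall>x\<in>K. g x = p s x)" for s
  proof -
    have "p s ` K \<subseteq> {0..1}" using p(2) by auto
    then show ?thesis
      using Tietze_extension_completely_regular[OF cr K(1) _ _ K(3)[of s], of "{0..1}"]
      by (metis is_interval_cc atLeastAtMost_iff empty_iff zero_le_one order_refl)
  qed
  then obtain P where P: "\<And>s. continuous_map X euclideanreal (P s)" "\<And>s. P s ` topspace X \<subseteq> {0..1}"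
    "\<And>s x. x \<in> K \<Longrightarrow> P s x = p s x" by metis
  define A where "A = K \<times> C"
  have A: "A \<in> sets M" using Times_borel_of[OF Kb Cb] D(1) by (simp add: A_def)
  have mA: "measure M A \<ge> 1/2"
  proof -
    have s: "(topspace X - K) \<times> topspace Y \<in> sets M" "topspace X \<times> (topspace Y - C) \<in> sets M"
      unfolding D(1) using Kb Cb topX topY by (auto intro!: Times_borel_of)
    have "measure m0 (topspace X - K) = measure M ((topspace X - K) \<times> topspace Y)"
    proof -
      have "fst -` (topspace X - K) \<inter> space M = (topspace X - K) \<times> topspace Y" by (auto simp: spM)
      moreover have "fst \<in> measurable M (borel_of X)"
        using fst_measurable_prod[of X Y] by (simp add: measurable_cong_sets[OF D(1) refl])
      ultimately show ?thesis unfolding m0_def using Kb topX by (subst measure_distr) auto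
    qed
    then have "measure M ((topspace X - K) \<times> topspace Y \<union> topspace X \<times> (topspace Y - C)) < 1/2"
      using K(2) offC measure_Un_le[OF s] by linarith
    moreover have "(topspace X - K) \<times> topspace Y \<union> topspace X \<times> (topspace Y - C) = space M - A"
      by (auto simp: spM A_def)
    ultimately show ?thesis using prob_compl[OF A] by simp
  qed
  let ?M1 = "conditional_measure M A"
  have M1: "radon_measure ?Z ?M1" "prob_space ?M1"
    using radon_halving[OF HZ M A mA] by auto
  have sM1: "sets ?M1 = sets (borel_of ?Z)" using radon_measureD[OF M1(1)] by simp
  define m where "m = distr ?M1 (borel_of X) fst"
  have m: "radon_measure X m" unfolding m_def
    using HZ H(1) M1(1) continuous_map_fst by (rule radon_measure_distr)
  have "fst \<in> measurable ?M1 (borel_of X)"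
    using fst_measurable_prod[of X Y] by (simp add: measurable_cong_sets[OF sM1 refl])
  then have pm: "prob_space m" unfolding m_def by (rule prob_space.prob_space_distr[OF M1(2)])
  obtain x where x: "ud_sequence t X m x" using ud[OF m pm] by blast
  have "C \<noteq> {}" using mA by (auto simp: A_def)
  have q: "slice X ?M1 (cell U C s) = density m (\<lambda>x. ennreal (node_prob (\<lambda>s. P s x) s))" for s
    unfolding m_def A_def
  proof (rule slice_conditional_measure[OF D(1,2) Cb cells cell_subset Kb p(3)])
    show "(\<lambda>x. node_prob (\<lambda>s. p s x) s) \<in> borel_measurable (borel_of X)"
      using p(1) by (rule node_prob_measurable)
    show "(\<lambda>x. node_prob (\<lambda>s. P s x) s) \<in> borel_measurable (borel_of X)"
      using P(1) by (intro continuous_map_borel_measurable continuous_map_node_prob)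
    show "node_prob (\<lambda>s. P s x) s = node_prob (\<lambda>s. p s x) s" if "x \<in> K" for x
      using P(3)[OF that] by simp
  qed
  have supp: "AE z in ?M1. snd z \<in> C"
  proof -
    have "AE z in ?M1. z \<in> A"
      unfolding conditional_measure_def using A by (subst AE_density) (auto simp: indicator_def)
    then show ?thesis by eventually_elim (auto simp: A_def)
  qed
  have "ud_sequence t ?Z ?M1
    (\<lambda>N. case prod_decode N of (i, j) \<Rightarrow> (x i, cell_point U C (route (\<lambda>s. P s (x i)) j j)))"
    using P(2) by (intro ud_sequence_continuous_transitions[OF H C \<open>C \<noteq> {}\<close> U cells sM1 M1(2) supp P(1)])
      (use q x in \<open>auto simp: m_def image_subset_iff\<close>)
  then show ?thesis using A mA by blast
qed

lemma ud_sequence_prod: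
  fixes X :: "'a topology" and Y :: "'b topology"
  assumes cr: "completely_regular_space X" and H: "Hausdorff_space X" "Hausdorff_space Y"
    and metr: "\<And>K. compactin Y K \<Longrightarrow> metrizable_space (subtopology Y K)"
    and ud: "\<And>m. radon_measure X m \<Longrightarrow> prob_space m \<Longrightarrow> \<exists>x. ud_sequence t X m x"
    and M: "radon_measure (prod_topology X Y) M" "prob_space M"
  shows "\<exists>z. ud_sequence t (prod_topology X Y) M z"
proof (rule ud_sequence_by_halving[OF _ M])
  fix N :: "('a \<times> 'b) measure" assume N: "radon_measure (prod_topology X Y) N" "prob_space N"
  have HZ: "Hausdorff_space (prod_topology X Y)" using H by (simp add: Hausdorff_space_prod_topology)
  obtain A z where A: "A \<in> sets N" "measure N A \<ge> 1/2" "ud_sequence t (prod_topology X Y) (conditional_measure N A) z"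
    using ud_sequence_on_half_of_mass[OF cr H metr ud N] by blast
  then show "\<exists>M1 M2. radon_measure (prod_topology X Y) M1 \<and> prob_space M1 \<and>
      radon_measure (prod_topology X Y) M2 \<and> prob_space M2 \<and>
      (\<exists>z. ud_sequence t (prod_topology X Y) M1 z) \<and>
      (\<forall>f\<in>bounded_continuous (prod_topology X Y). integral\<^sup>L N f = (integral\<^sup>L M1 f + integral\<^sup>L M2 f) / 2)"
    using radon_halving[OF HZ N A(1,2)] by blast
qed

theorem mainTheorem1:
  fixes X :: "'a topology" and Y :: "'b topology"
  assumes "completely_regular_space X" and "Hausdorff_space X"
    and "completely_regular_space Y" and "Hausdorff_space Y"
    and "topspace Y \<noteq> {}"
    and "\<And>K. compactin Y K \<Longrightarrow> metrizable_space (subtopology Y K)"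
  shows "(property_tud X \<longrightarrow> property_tud (prod_topology X Y)) \<and>
         (property_ud X \<longrightarrow> property_ud (prod_topology X Y))"
proof -
  have "Hausdorff_space (prod_topology X Y)" using assms(2,4) by (simp add: Hausdorff_space_prod_topology)
  then show ?thesis
    using ud_sequence_prod[OF assms(1,2,4,6)]
    by (simp add: property_ud_iff property_tud_iff assms(2))
qed

end
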